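(* Let $D$ be a division ring with infinite center $F$, let $n\ge 1$, and let $G$ be an almost subnormal subgroup of $\mathrm{GL}_n(D)$. If $G$ satisfies a generalized group identity over $\mathrm{GL}_n(D)$, then $G$ is central, i.e. $G$ is contained in the center of $\mathrm{GL}_n(D)$.
   Context: A subgroup $H$ of a group $K$ is almost subnormal in $K$ if there is a chain of subgroups $H=H_r\le H_{r-1}\le\cdots\le H_1=K$ such that for each $1<i\le r$, either $H_i$ is normal in $H_{i-1}$ or $H_i$ has finite index in $H_{i-1}$. For a group $K$, a generalized group monomial over $K$ is an expression $w(x_1,\dots,x_m)=a_1x_{i_1}^{\alpha_1}a_2x_{i_2}^{\alpha_2}\cdots a_tx_{i_t}^{\alpha_t}a_{t+1}$ with $t,m\ge 1$, $i_j\in\{1,\dots,m\}$, $a_j\in K$, $\alpha_j\in\mathbb{Z}\setminus\{0\}$, such that whenever $i_j=i_{j+1}$ and $\alpha_j\alpha_{j+1}<0$, the coefficient standing between $x_{i_j}^{\alpha_j}$ and $x_{i_{j+1}}^{\alpha_{j+1}}$ is not in the center $Z(K)$. A subgroup $H\le K$ satisfies the generalized group identity $w=1$ over $K$ if $w(c_1,\dots,c_m)=1$ for all $c_1,\dots,c_m\in H$. *)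

theory Defs
  imports "HOL-Analysis.Analysis" "HOL-Algebra.Algebra"
begin

text \<open>Center of a division ring (as a subset of the ring).\<close>
definition ring_center :: "'a::division_ring set" where
  "ring_center = {c. \<forall>x. c * x = x * c}"

text \<open>The general linear group GL_n(D), n = CARD('n) \<ge> 1, as an HOL-Algebra monoid.\<close>
definition GL_mat :: "('a::division_ring ^'n^'n) monoid" where
  "GL_mat = \<lparr> carrier = {A. \<exists>B. A ** B = mat 1 \<and> B ** A = mat 1},
              mult = (**), one = mat 1 \<rparr>"

text \<open>Center of a group.\<close>
definition group_center :: "('g, 'b) monoid_scheme \<Rightarrow> 'g set" where
  "group_center K = {z \<in> carrier K. \<forall>x \<in> carrier K. z \<otimes>\<^bsub>K\<^esub> x = x \<otimes>\<^bsub>K\<^esub> z}"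

text \<open>Almost subnormal subgroups: chains where each step is normal or of finite index.\<close>
inductive almost_subnormal :: "('g, 'b) monoid_scheme \<Rightarrow> 'g set \<Rightarrow> bool" for K where
  base: "almost_subnormal K (carrier K)"
| normal_step: "almost_subnormal K L \<Longrightarrow> normal H (K\<lparr>carrier := L\<rparr>) \<Longrightarrow> almost_subnormal K H"
| finite_index_step: "almost_subnormal K L \<Longrightarrow> subgroup H (K\<lparr>carrier := L\<rparr>)
      \<Longrightarrow> finite (rcosets\<^bsub>K\<lparr>carrier := L\<rparr>\<^esub> H) \<Longrightarrow> almost_subnormal K H"

text \<open>A generalized group monomial a_1 x_{i_1}^{alpha_1} ... a_t x_{i_t}^{alpha_t} a_{t+1}
  is represented by the list ws = [(a_1,i_1,alpha_1),...,(a_t,i_t,alpha_t)] and the final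
  coefficient a_{t+1}; variables are indexed by naturals.\<close>
definition gen_monomial :: "('g, 'b) monoid_scheme \<Rightarrow> ('g \<times> nat \<times> int) list \<Rightarrow> 'g \<Rightarrow> bool" where
  "gen_monomial K ws a_last \<longleftrightarrow>
     ws \<noteq> [] \<and> a_last \<in> carrier K \<and>
     (\<forall>(a, i, \<alpha>) \<in> set ws. a \<in> carrier K \<and> \<alpha> \<noteq> 0) \<and>
     (\<forall>j. Suc j < length ws \<longrightarrow>
        (let (_, i, \<alpha>) = ws ! j; (b, i', \<beta>) = ws ! Suc j in
          i = i' \<and> \<alpha> * \<beta> < 0 \<longrightarrow> b \<notin> group_center K))"

fun eval_monomial :: "('g, 'b) monoid_scheme \<Rightarrow> ('g \<times> nat \<times> int) list \<Rightarrow> 'g \<Rightarrow> (nat \<Rightarrow> 'g) \<Rightarrow> 'g" where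
  "eval_monomial K [] a_last c = a_last"
| "eval_monomial K ((a, i, \<alpha>) # ws) a_last c =
     a \<otimes>\<^bsub>K\<^esub> (c i [^]\<^bsub>K\<^esub> \<alpha>) \<otimes>\<^bsub>K\<^esub> eval_monomial K ws a_last c"

definition satisfies_ggi :: "('g, 'b) monoid_scheme \<Rightarrow> 'g set \<Rightarrow> bool" where
  "satisfies_ggi K H \<longleftrightarrow> (\<exists>ws a_last. gen_monomial K ws a_last \<and>
     (\<forall>c. (\<forall>i. c i \<in> H) \<longrightarrow> eval_monomial K ws a_last c = \<one>\<^bsub>K\<^esub>))"

end

theory Submission
  imports Defs "HOL-Library.Sublist"
begin

text \<open>An identity on a noncentral almost subnormal subgroup propagates up the chain to
  \<open>GL\<^sub>n(D)\<close>: through a finite index step by substituting powers, and through a normal step by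
  substituting conjugates \<open>y g y\<^sup>-\<^sup>1\<close> of a noncentral \<open>g\<close>.

  An identity of \<open>GL\<^sub>n(D)\<close> is then expanded at \<open>x\<^sub>i = 1 + t y\<^sub>i\<close>, with \<open>t\<close> central. It holds for all but
  finitely many central \<open>t\<close>; since its values satisfy an equation linear in \<open>t\<close> on a finite-dimensional
  space and the center is infinite, every coefficient of the formal power series vanishes. These
  coefficients are polynomial in the \<open>y\<^sub>i\<close>, so they also vanish when the \<open>y\<^sub>i\<close> are taken from the
  algebra of operators on \<open>D\<^sup>n\<close> generated by the matrices and the right multiplication by some
  \<open>a \<in> D\<close>. By the density theorem this algebra imitates, on finitely many vectors, every operator
  that is linear over the centralizer \<open>C\<close> of \<open>a\<close>. Unless \<open>GL\<^sub>n(D)\<close> is commutative, \<open>a\<close> can be chosen so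
  that \<open>D\<^sup>n\<close> has dimension at least two over \<open>C\<close>, and generic square-zero operators of rank one then
  make the top coefficient nonzero.\<close>

section \<open>Generalized group identities and almost subnormal subgroups\<close>

text \<open>Two obstacles shape the argument. \<open>D\<close> may have infinite dimension over its
  center; the only finiteness at hand is that \<open>D\<^sup>n\<close> has finite right dimension
  over \<open>D\<close>. So the values of a word are not treated as rational functions of
  \<open>t\<close>: they solve a linear equation with a central parameter, and the formal
  coefficients are combinations of finitely many such values. The second obstacle is n = 1, where a
  matrix is just an element of \<open>D\<close> and no nonzero one squares to zero. Adjoining the
  right multiplication by \<open>a\<close> shrinks the commuting scalars from \<open>D\<close> to
  \<open>C\<close>, which makes room for operators that kill one vector but not another. In the top
  coefficient a coefficient \<open>A\<close> between two occurrences of one variable appears as y A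
  y, where y kills v and has its image in v C. This is nonzero only if A v leaves v C, and a matrix
  that preserves all lines v C is central: this is how noncentrality of the coefficients is
  used.\<close>

lemma successively_iff_nth:
  "successively P xs \<longleftrightarrow> (\<forall>j. Suc j < length xs \<longrightarrow> P (xs ! j) (xs ! Suc j))"
proof (induction P xs rule: successively.induct)
  case (3 P x y xs)
  have "(\<forall>j. R j) \<longleftrightarrow> R 0 \<and> (\<forall>j. R (Suc j))" for R :: "nat \<Rightarrow> bool"
    by (metis not0_implies_Suc)
  from this[of "\<lambda>j. Suc j < length (x # y # xs) \<longrightarrow> P ((x # y # xs) ! j) ((x # y # xs) ! Suc j)"]
  show ?case using 3 by simp
qed auto

lemma gen_monomial_iff_successively:
  "gen_monomial K ws l \<longleftrightarrow> ws \<noteq> [] \<and> l \<in> carrier K \<and>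
     (\<forall>(a, i, \<alpha>) \<in> set ws. a \<in> carrier K \<and> \<alpha> \<noteq> 0) \<and>
     successively (\<lambda>(_, i, \<alpha>) (b, j, \<beta>). i = j \<and> \<alpha> * \<beta> < 0 \<longrightarrow> b \<notin> group_center K) ws"
  unfolding gen_monomial_def successively_iff_nth by (simp add: Let_def case_prod_unfold)

text \<open>\<open>gen_monomial\<close> tolerates a central coefficient between powers of one
  variable with equal signs. Both the substitution of conjugates and the nonvanishing of the top
  coefficient would fail there, so this normal form excludes such neighbours.\<close>

definition alternating :: "('g, 'b) monoid_scheme \<Rightarrow> ('g \<times> nat \<times> int) list \<Rightarrow> bool" where
  "alternating K ws \<longleftrightarrow> (\<forall>(a, i, \<alpha>) \<in> set ws. a \<in> carrier K \<and> \<bar>\<alpha>\<bar> = 1) \<and>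
     successively (\<lambda>(_, i, \<alpha>) (b, j, \<beta>). i = j \<longrightarrow> \<beta> = - \<alpha> \<and> b \<notin> group_center K) ws"

context group begin

lemma eval_monomial_closed:
  assumes "l \<in> carrier G" "\<forall>(a, i, \<alpha>) \<in> set ws. a \<in> carrier G" "\<forall>i. c i \<in> carrier G"
  shows "eval_monomial G ws l c \<in> carrier G"
  using assms by (induction ws) auto

section \<open>Replacing every variable by a product of two\<close>

fun block :: "'a \<Rightarrow> nat \<Rightarrow> nat \<Rightarrow> int \<Rightarrow> nat \<Rightarrow> ('a \<times> nat \<times> int) list" where
  "block a j k e 0 = []"
| "block a j k e (Suc n) = (a, j, e) # (\<one>, k, e) # block \<one> j k e n"

lemma block_nonempty: "n > 0 \<Longrightarrow> block a j k e n \<noteq> [] \<and> hd (block a j k e n) = (a, j, e) \<and>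
    (\<exists>b. last (block a j k e n) = (b, k, e))"
proof (induction n arbitrary: a)
  case (Suc n)
  then show ?case by (cases n) auto
qed simp

lemma alternating_block:
  assumes "a \<in> carrier G" "j \<noteq> k" "\<bar>e\<bar> = 1"
  shows "alternating G (block a j k e n)"
  using assms
proof (induction n arbitrary: a)
  case (Suc n)
  have "alternating G (block \<one> j k e n)" using Suc by simp
  then show ?case using Suc.prems block_nonempty[of n \<one> j k e]
    by (cases "n = 0") (auto simp: alternating_def successively_Cons)
qed (simp add: alternating_def)

lemma eval_block:
  assumes "a \<in> carrier G" "\<forall>i. c i \<in> carrier G" "eval_monomial G ws l c \<in> carrier G"
  shows "eval_monomial G (block a j k e (Suc n) @ ws) l c =
    a \<otimes> ((c j [^] e \<otimes> c k [^] e) [^] Suc n) \<otimes> eval_monomial G ws l c"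
  using assms
proof (induction n arbitrary: a)
  case 0
  then show ?case by (simp add: m_assoc)
next
  case (Suc n)
  let ?u = "c j [^] e \<otimes> c k [^] e"
  have u: "?u \<in> carrier G" using Suc.prems by simp
  have "eval_monomial G (block a j k e (Suc (Suc n)) @ ws) l c =
      a \<otimes> c j [^] e \<otimes> (\<one> \<otimes> c k [^] e \<otimes> eval_monomial G (block \<one> j k e (Suc n) @ ws) l c)"
    by simp
  also have "eval_monomial G (block \<one> j k e (Suc n) @ ws) l c =
      \<one> \<otimes> (?u [^] Suc n) \<otimes> eval_monomial G ws l c"
    by (rule Suc.IH) (use Suc.prems in auto)
  also have "a \<otimes> c j [^] e \<otimes> (\<one> \<otimes> c k [^] e \<otimes> (\<one> \<otimes> (?u [^] Suc n) \<otimes> eval_monomial G ws l c))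
     = a \<otimes> (?u \<otimes> ?u [^] Suc n) \<otimes> eval_monomial G ws l c"
    using Suc.prems u by (simp add: m_assoc del: nat_pow_Suc)
  also have "?u \<otimes> ?u [^] Suc n = ?u [^] Suc (Suc n)"
    using nat_pow_Suc2[OF u] by metis
  finally show ?case .
qed

text \<open>A positive block starts with an even and ends with an odd variable; a negative block,
  being an inverse, starts odd and ends even. Blocks of equal sign therefore meet in different
  variables. Equal variables can meet only at a change of sign, where \<open>gen_monomial\<close>
  makes the coefficient noncentral.\<close>

fun split_vars :: "('a \<times> nat \<times> int) list \<Rightarrow> ('a \<times> nat \<times> int) list" where
  "split_vars [] = []"
| "split_vars ((a, i, \<alpha>) # ws) =
    (if \<alpha> > 0 then block a (2 * i) (2 * i + 1) 1 (nat \<alpha>)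
     else block a (2 * i + 1) (2 * i) (- 1) (nat (- \<alpha>))) @ split_vars ws"

lemma hd_split_vars:
  assumes "\<alpha> \<noteq> 0"
  shows "split_vars ((a, i, \<alpha>) # ws) \<noteq> []"
    and "hd (split_vars ((a, i, \<alpha>) # ws)) = (if \<alpha> > 0 then (a, 2 * i, 1) else (a, 2 * i + 1, - 1))"
  using assms block_nonempty[of "nat \<alpha>" a "2 * i" "2 * i + 1" 1]
    block_nonempty[of "nat (- \<alpha>)" a "2 * i + 1" "2 * i" "- 1"] by auto

lemma alternating_append:
  "alternating G (xs @ ys) \<longleftrightarrow> alternating G xs \<and> alternating G ys \<and>
    (xs = [] \<or> ys = [] \<or> (case last xs of (_, i, \<alpha>) \<Rightarrow> case hd ys of (b, j, \<beta>) \<Rightarrow>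
       i = j \<longrightarrow> \<beta> = - \<alpha> \<and> b \<notin> group_center G))"
  unfolding alternating_def successively_append_iff set_append ball_Un case_prod_unfold by blast

lemma alternating_split_vars:
  assumes "\<forall>(a, i, \<alpha>) \<in> set ws. a \<in> carrier G \<and> \<alpha> \<noteq> 0"
    and "successively (\<lambda>(_, i, \<alpha>) (b, j, \<beta>). i = j \<and> \<alpha> * \<beta> < 0 \<longrightarrow> b \<notin> group_center G) ws"
  shows "alternating G (split_vars ws)"
  using assms
proof (induction ws)
  case Nil
  then show ?case by (simp add: alternating_def)
next
  case (Cons w ws)
  obtain a i \<alpha> where w: "w = (a, i, \<alpha>)" by (cases w) auto
  have IH: "alternating G (split_vars ws)" using Cons by (auto simp: successively_Cons)
  have a: "a \<in> carrier G" "\<alpha> \<noteq> 0" using Cons.prems(1) w by auto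
  have P: "alternating G (block a (2 * i) (2 * i + 1) 1 (nat \<alpha>))"
    "alternating G (block a (2 * i + 1) (2 * i) (- 1) (nat (- \<alpha>)))"
    by (rule alternating_block; use a in simp)+
  obtain B where B: "B = (if \<alpha> > 0 then block a (2 * i) (2 * i + 1) 1 (nat \<alpha>)
     else block a (2 * i + 1) (2 * i) (- 1) (nat (- \<alpha>)))" by simp
  have altB: "alternating G B" using P B by simp
  have lastB: "\<exists>b. last B = (if \<alpha> > 0 then (b, 2 * i + 1, 1) else (b, 2 * i, - 1))"
    using B a(2) block_nonempty[of "nat \<alpha>" a "2 * i" "2 * i + 1" 1]
      block_nonempty[of "nat (- \<alpha>)" a "2 * i + 1" "2 * i" "- 1"] by auto
  show ?case
  proof (cases ws)
    case Nil
    then show ?thesis using altB B w by simp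
  next
    case (Cons w' ws')
    obtain b j \<beta> where w': "w' = (b, j, \<beta>)" by (cases w') auto
    have \<beta>: "\<beta> \<noteq> 0" using \<open>\<forall>(a, i, \<alpha>) \<in> set (w # ws). _\<close> Cons w' by auto
    have junction: "i = j \<and> \<alpha> * \<beta> < 0 \<longrightarrow> b \<notin> group_center G"
      using \<open>successively _ (w # ws)\<close> Cons w' w by simp
    have hd: "hd (split_vars ws) = (if \<beta> > 0 then (b, 2 * j, 1) else (b, 2 * j + 1, - 1))"
      unfolding Cons w' by (rule hd_split_vars(2)[OF \<beta>])
    have parity: "2 * i + 1 \<noteq> 2 * j" "2 * i \<noteq> 2 * j + 1" by presburger+
    have "split_vars (w # ws) = B @ split_vars ws" using B w by simp
    then show ?thesis
      using altB IH lastB junction a(2) \<beta> parity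
      by (auto simp: alternating_append hd mult_less_0_iff split: if_splits)
  qed
qed

lemma eval_split_vars:
  assumes "l \<in> carrier G" "\<forall>(a, i, \<alpha>) \<in> set ws. a \<in> carrier G \<and> \<alpha> \<noteq> 0" "\<forall>i. c i \<in> carrier G"
  shows "eval_monomial G (split_vars ws) l c =
    eval_monomial G ws l (\<lambda>i. c (2 * i) \<otimes> c (2 * i + 1))"
  using assms(2)
proof (induction ws)
  case (Cons w ws)
  obtain a i \<alpha> where w: "w = (a, i, \<alpha>)" by (cases w) auto
  have a: "a \<in> carrier G" "\<alpha> \<noteq> 0" using Cons.prems w by auto
  have IH: "eval_monomial G (split_vars ws) l c =
    eval_monomial G ws l (\<lambda>i. c (2 * i) \<otimes> c (2 * i + 1))" using Cons by auto
  have E: "eval_monomial G (split_vars ws) l c \<in> carrier G"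
    unfolding IH by (rule eval_monomial_closed) (use assms Cons in auto)
  show ?case
  proof (cases "\<alpha> > 0")
    case True
    then obtain n where n: "nat \<alpha> = Suc n" by (metis gr0_implies_Suc zero_less_nat_eq)
    have pow: "x [^] Suc n = x [^] \<alpha>" for x
      using True n by (metis less_imp_le pow_nat)
    have "split_vars (w # ws) = block a (2 * i) (2 * i + 1) 1 (Suc n) @ split_vars ws"
      using True n w by simp
    then show ?thesis
      using eval_block[OF a(1) assms(3) E, of "2 * i" "2 * i + 1" 1 n] assms(3)
      by (simp only: pow) (simp add: w IH)
  next
    case False
    then obtain n where n: "nat (- \<alpha>) = Suc n" using a(2) by (metis gr0_implies_Suc linorder_neqE_linordered_idom neg_0_less_iff_less zero_less_nat_eq)
    have pow: "(inv x) [^] Suc n = x [^] \<alpha>" if "x \<in> carrier G" for x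
      using False n that a(2) by (simp only: nat_pow_inv int_pow_def2) auto
    have inv: "x [^] (- 1 :: int) = inv x" if "x \<in> carrier G" for x
      using that by (simp add: int_pow_neg)
    have "split_vars (w # ws) = block a (2 * i + 1) (2 * i) (- 1) (Suc n) @ split_vars ws"
      using False n w by simp
    moreover have "c (2 * i + 1) [^] (- 1 :: int) \<otimes> c (2 * i) [^] (- 1 :: int)
        = inv (c (2 * i) \<otimes> c (2 * i + 1))"
      using assms(3) by (simp add: inv inv_mult_group)
    ultimately show ?thesis
      using eval_block[OF a(1) assms(3) E, of "2 * i + 1" "2 * i" "- 1" n] assms(3)
        pow[of "c (2 * i) \<otimes> c (2 * i + 1)"]
      by (simp add: w IH del: nat_pow_Suc)
  qed
qed simp

text \<open>Substituting \<open>x\<^sub>2\<^sub>i x\<^sub>2\<^sub>i\<^sub>+\<^sub>1\<close> for \<open>x\<^sub>i\<close> separates equal neighbours of the same sign, whose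
  coefficient is allowed to be central.\<close>

lemma satisfies_ggi_alternating:
  assumes "subgroup H G" "satisfies_ggi G H"
  obtains ws l where "ws \<noteq> []" "alternating G ws" "l \<in> carrier G"
    "\<And>c. (\<forall>i. c i \<in> H) \<Longrightarrow> eval_monomial G ws l c = \<one>"
proof -
  obtain ws l where w: "gen_monomial G ws l"
    and ev: "\<And>c. (\<forall>i. c i \<in> H) \<Longrightarrow> eval_monomial G ws l c = \<one>"
    using assms(2) unfolding satisfies_ggi_def by blast
  have w': "ws \<noteq> []" "l \<in> carrier G" "\<forall>(a, i, \<alpha>) \<in> set ws. a \<in> carrier G \<and> \<alpha> \<noteq> 0"
    "successively (\<lambda>(_, i, \<alpha>) (b, j, \<beta>). i = j \<and> \<alpha> * \<beta> < 0 \<longrightarrow> b \<notin> group_center G) ws"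
    using w unfolding gen_monomial_iff_successively by auto
  show thesis
  proof (rule that)
    show "split_vars ws \<noteq> []"
    proof (cases ws)
      case (Cons x xs)
      obtain a i \<alpha> where x: "x = (a, i, \<alpha>)" by (cases x) auto
      then show ?thesis using hd_split_vars(1)[of \<alpha> a i xs] w'(3) Cons by auto
    qed (use w' in simp)
    show "alternating G (split_vars ws)" by (rule alternating_split_vars[OF w'(3,4)])
    fix c :: "nat \<Rightarrow> 'a" assume c: "\<forall>i. c i \<in> H"
    then have "\<forall>i. c i \<in> carrier G" using assms(1) by (meson subgroup.mem_carrier)
    then have "eval_monomial G (split_vars ws) l c =
        eval_monomial G ws l (\<lambda>i. c (2 * i) \<otimes> c (2 * i + 1))"
      by (rule eval_split_vars[OF w'(2,3)])
    also have "\<dots> = \<one>" by (rule ev) (use c assms(1) in \<open>simp add: subgroup.m_closed\<close>)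
    finally show "eval_monomial G (split_vars ws) l c = \<one>" .
  qed (rule w'(2))
qed

section \<open>Normal steps: substituting conjugates of a noncentral element\<close>

fun conj_vars :: "'a \<Rightarrow> ('a \<times> nat \<times> int) list \<Rightarrow> ('a \<times> nat \<times> int) list" where
  "conj_vars g [] = []"
| "conj_vars g ((a, i, \<alpha>) # ws) = (a, i, 1) # (g [^] \<alpha>, i, - 1) # conj_vars g ws"

lemma inv_mem_group_center: 
  assumes "x \<in> carrier G" "inv x \<in> group_center G" shows "x \<in> group_center G"
proof -
  have "x \<otimes> y = y \<otimes> x" if y: "y \<in> carrier G" for y
  proof -
    have "inv x \<otimes> y = y \<otimes> inv x" using assms(2) y by (simp add: group_center_def)
    then have "x \<otimes> (inv x \<otimes> y) \<otimes> x = x \<otimes> (y \<otimes> inv x) \<otimes> x" by simp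
    moreover have "x \<otimes> (inv x \<otimes> y) \<otimes> x = y \<otimes> x" using assms(1) y by (simp add: m_assoc[symmetric])
    moreover have "x \<otimes> (y \<otimes> inv x) \<otimes> x = x \<otimes> y" using assms(1) y by (simp add: m_assoc)
    ultimately show ?thesis by simp
  qed
  then show ?thesis using assms by (simp add: group_center_def)
qed

text \<open>After the substitution every letter becomes a pair with exponents 1 and -1 around a
  power of \<open>g\<close>, which is noncentral since the exponent is 1 or -1. Between two pairs of
  the same variable the sign changes again, whatever the original signs were, so the old coefficient
  must be noncentral: hence the passage through \<open>alternating\<close>.\<close>

lemma satisfies_ggi_normal:
  assumes L: "subgroup L G" and N: "normal H (G\<lparr>carrier := L\<rparr>)" and H: "satisfies_ggi G H"
    and nc: "\<not> H \<subseteq> group_center G"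
  shows "satisfies_ggi G L"
proof -
  have HL: "subgroup H (G\<lparr>carrier := L\<rparr>)" using N normal.axioms(1) by blast
  have HG: "subgroup H G" by (rule incl_subgroup[OF L HL])
  have HsubL: "H \<subseteq> L" using subgroup.subset[OF HL] by simp
  obtain g where g: "g \<in> H" "g \<notin> group_center G" using nc by blast
  have gG: "g \<in> carrier G" using g HG by (meson subgroup.mem_carrier)
  have gpow: "g [^] \<alpha> \<in> carrier G \<and> g [^] \<alpha> \<notin> group_center G" if "\<bar>\<alpha>\<bar> = 1" for \<alpha> :: int
  proof -
    from that have "\<alpha> = 1 \<or> \<alpha> = - 1" by auto
    then show ?thesis using g gG inv_mem_group_center by (auto simp: int_pow_neg)
  qed
  obtain ws l where w: "ws \<noteq> []" "alternating G ws" "l \<in> carrier G"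
    and ev: "\<And>c. (\<forall>i. c i \<in> H) \<Longrightarrow> eval_monomial G ws l c = \<one>"
    using satisfies_ggi_alternating[OF HG H] by blast
  have ne: "conj_vars g ws \<noteq> []" using w(1) by (cases ws) auto
  have mem: "\<forall>(a, i, \<alpha>) \<in> set (conj_vars g ws). a \<in> carrier G \<and> \<alpha> \<noteq> 0"
    proof -
    have "\<forall>(a, i, \<alpha>) \<in> set ws. a \<in> carrier G \<and> \<bar>\<alpha>\<bar> = 1"
      using w(2) unfolding alternating_def by blast
    then show ?thesis by (induction ws) (auto simp: gpow)
  qed
  have succ: "successively (\<lambda>(_, i, \<alpha>) (b, j, \<beta>). i = j \<and> \<alpha> * \<beta> < 0 \<longrightarrow> b \<notin> group_center G)
      (conj_vars g ws)"
    using w(2) unfolding alternating_def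
  proof (induction ws)
    case (Cons x xs)
    obtain a i \<alpha> where x: "x = (a, i, \<alpha>)" by (cases x) auto
    have \<alpha>: "\<bar>\<alpha>\<bar> = 1" using Cons.prems x by auto
    show ?case
    proof (cases xs)
      case Nil
      then show ?thesis using gpow[OF \<alpha>] x by simp
    next
      case (Cons y ys)
      obtain b j \<beta> where y: "y = (b, j, \<beta>)" by (cases y) auto
      have "successively (\<lambda>(_, i, \<alpha>) (b, j, \<beta>). i = j \<and> \<alpha> * \<beta> < 0 \<longrightarrow> b \<notin> group_center G)
        (conj_vars g xs)"
        using Cons.IH Cons.prems by (auto simp: successively_Cons)
      moreover have "i = j \<longrightarrow> b \<notin> group_center G"
        using Cons.prems Cons x y by auto
      ultimately show ?thesis using gpow[OF \<alpha>] x y Cons by simp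
    qed
  qed simp
  have "eval_monomial G (conj_vars g ws) l c = \<one>" if c: "\<forall>i. c i \<in> L" for c
  proof -
    have cG: "\<forall>i. c i \<in> carrier G" using c L by (meson subgroup.mem_carrier)
    have "\<forall>(a, i, \<alpha>) \<in> set ws. a \<in> carrier G \<and> \<bar>\<alpha>\<bar> = 1" using w(2) unfolding alternating_def by blast
    then have "eval_monomial G (conj_vars g ws) l c = eval_monomial G ws l (\<lambda>i. c i \<otimes> g \<otimes> inv (c i))"
    proof (induction ws)
      case (Cons x xs)
      obtain a i \<alpha> where x: "x = (a, i, \<alpha>)" by (cases x) auto
      have a: "a \<in> carrier G" "\<bar>\<alpha>\<bar> = 1" using Cons.prems x by auto
      let ?E = "eval_monomial G xs l (\<lambda>i. c i \<otimes> g \<otimes> inv (c i))"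
      have E: "?E \<in> carrier G"
        by (rule eval_monomial_closed) (use w(3) Cons.prems cG gG in auto)
      have pow: "(c i \<otimes> g \<otimes> inv (c i)) [^] \<alpha> = c i \<otimes> g [^] \<alpha> \<otimes> inv (c i)"
      proof -
        from a(2) consider "\<alpha> = 1" | "\<alpha> = - 1" by linarith
        then show ?thesis
        proof cases
          case 2
          then show ?thesis using cG gG by (simp add: int_pow_neg inv_mult_group m_assoc)
        qed (use cG gG in simp)
      qed
      have "eval_monomial G (conj_vars g (x # xs)) l c
          = a \<otimes> c i \<otimes> (g [^] \<alpha> \<otimes> inv (c i) \<otimes> ?E)"
        using Cons x cG by (simp add: int_pow_neg)
      also have "\<dots> = a \<otimes> (c i \<otimes> g [^] \<alpha> \<otimes> inv (c i)) \<otimes> ?E"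
        using a cG gG E by (simp add: m_assoc)
      finally show ?case by (simp add: x pow)
    qed simp
    also have "\<dots> = \<one>"
    proof (rule ev, intro allI)
      fix i
      have "c i \<otimes>\<^bsub>G\<lparr>carrier := L\<rparr>\<^esub> g \<otimes>\<^bsub>G\<lparr>carrier := L\<rparr>\<^esub> inv\<^bsub>G\<lparr>carrier := L\<rparr>\<^esub> (c i) \<in> H"
        using normal.inv_op_closed2[OF N _ g(1), of "c i"] c by simp
      then show "c i \<otimes> g \<otimes> inv (c i) \<in> H"
        using c L by (simp add: m_inv_consistent)
    qed
    finally show ?thesis .
  qed
  then show ?thesis using ne mem succ w(3)
    unfolding satisfies_ggi_def gen_monomial_iff_successively by blast
qed

text \<open>\<open>H\<close> need not be normal in \<open>L\<close>, so the index itself may fail as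
  exponent. Two of the cosets of the powers \<open>x [^] 0\<close>, ..., \<open>x [^] N\<close>
  coincide, where N is the index, which puts some \<open>x [^] (j - i)\<close> with
  \<open>j - i\<close> at most N into \<open>H\<close>. The factorial of N is a multiple of all
  these differences and so serves every \<open>x\<close>.\<close>

lemma finite_index_power:
  assumes L: "subgroup L G" and HL: "subgroup H (G\<lparr>carrier := L\<rparr>)"
    and fin: "finite (rcosets\<^bsub>G\<lparr>carrier := L\<rparr>\<^esub> H)"
  obtains e :: nat where "e > 0" "\<And>x. x \<in> L \<Longrightarrow> x [^] e \<in> H"
proof
  let ?R = "rcosets\<^bsub>G\<lparr>carrier := L\<rparr>\<^esub> H"
  interpret L: group "G\<lparr>carrier := L\<rparr>" by (rule subgroup.subgroup_is_group[OF L is_group])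
  have HG: "subgroup H G" by (rule incl_subgroup[OF L HL])
  show "fact (card ?R) > (0 :: nat)" by simp
  fix x assume x: "x \<in> L"
  have xG: "x \<in> carrier G" using x L by (meson subgroup.mem_carrier)
  have xn: "x [^] (n::nat) \<in> L" for n
    by (induction n) (use x L in \<open>auto simp: subgroup.one_closed subgroup.m_closed\<close>)
  define f where "f n = H #>\<^bsub>G\<lparr>carrier := L\<rparr>\<^esub> (x [^] (n::nat))" for n
  have "f ` {..card ?R} \<subseteq> ?R" using xn unfolding f_def RCOSETS_def by auto
  then have "card (f ` {..card ?R}) \<le> card ?R" by (rule card_mono[OF fin])
  then have "\<not> inj_on f {..card ?R}" using card_image[of f "{..card ?R}"] by auto
  then obtain i j where ij: "i < j" "j \<le> card ?R" "f i = f j"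
    unfolding inj_on_def by (metis atMost_iff linorder_neqE_nat)
  have "x [^] j \<in> f i" unfolding ij(3) unfolding f_def by (rule L.rcos_self) (use xn HL in auto)
  then obtain h where h: "h \<in> H" "x [^] j = h \<otimes> x [^] i" unfolding f_def r_coset_def by auto
  have hG: "h \<in> carrier G" using h HG by (meson subgroup.mem_carrier)
  have "x [^] (j - i) \<otimes> x [^] i = h \<otimes> x [^] i" using h(2) ij(1) xG by (simp add: nat_pow_mult)
  then have "x [^] (j - i) = h" using xG hG by (simp add: r_cancel)
  then have ji: "x [^] (j - i) \<in> H" using h by simp
  have "(j - i) dvd fact (card ?R)" using ij by (intro dvd_fact) auto
  then obtain m where m: "fact (card ?R) = (j - i) * m" by (elim dvdE)
  have "(x [^] (j - i)) [^] m \<in> H"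
    by (induction m) (use ji HG in \<open>auto simp: subgroup.one_closed subgroup.m_closed\<close>)
  then show "x [^] (fact (card ?R) :: nat) \<in> H" using m xG by (simp add: nat_pow_pow)
qed

lemma satisfies_ggi_finite_index:
  assumes L: "subgroup L G" and HL: "subgroup H (G\<lparr>carrier := L\<rparr>)"
    and fin: "finite (rcosets\<^bsub>G\<lparr>carrier := L\<rparr>\<^esub> H)" and H: "satisfies_ggi G H"
  shows "satisfies_ggi G L"
proof -
  obtain e :: nat where e: "e > 0" "\<And>x. x \<in> L \<Longrightarrow> x [^] e \<in> H"
    using finite_index_power[OF L HL fin] by blast
  obtain ws l where w: "gen_monomial G ws l"
    and ev: "\<And>c. (\<forall>i. c i \<in> H) \<Longrightarrow> eval_monomial G ws l c = \<one>"
    using H unfolding satisfies_ggi_def by blast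
  let ?f = "\<lambda>(a, i, \<alpha>). (a, i, int e * \<alpha>)"
  have sgn: "int e * \<alpha> * (int e * \<beta>) < 0 \<longleftrightarrow> \<alpha> * \<beta> < 0" for \<alpha> \<beta>
    using e(1) by (auto simp: mult_less_0_iff zero_less_mult_iff)
  have "gen_monomial G (map ?f ws) l"
    using w e(1) unfolding gen_monomial_iff_successively
    by (auto simp: successively_map case_prod_unfold sgn)
  moreover have "eval_monomial G (map ?f ws) l c = \<one>" if c: "\<forall>i. c i \<in> L" for c
  proof -
    have cG: "c i \<in> carrier G" for i using c L by (meson subgroup.mem_carrier)
    have "eval_monomial G (map ?f ws) l c = eval_monomial G ws l (\<lambda>i. c i [^] e)"
      by (induction ws) (auto simp: int_pow_pow[OF cG, symmetric] int_pow_int)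
    then show ?thesis using ev e(2) c by simp
  qed
  ultimately show ?thesis unfolding satisfies_ggi_def by blast
qed

text \<open>Each member of the chain contains the next one, so noncentrality climbs together with
  the identity and is available again at every normal step.\<close>

lemma satisfies_ggi_almost_subnormal:
  assumes "almost_subnormal G H" "satisfies_ggi G H" "\<not> H \<subseteq> group_center G"
  shows "satisfies_ggi G (carrier G)"
proof -
  have "subgroup H G \<and> (satisfies_ggi G H \<longrightarrow> \<not> H \<subseteq> group_center G \<longrightarrow> satisfies_ggi G (carrier G))"
    using assms(1)
  proof induction
    case base
    show ?case using subgroup_self by simp
  next
    case (normal_step L H)
    have HL: "subgroup H (G\<lparr>carrier := L\<rparr>)" using normal_step normal.axioms(1) by blast
    then show ?case
      using normal_step satisfies_ggi_normal incl_subgroup subgroup.subset[OF HL] by auto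
  next
    case (finite_index_step L H)
    then show ?case
      using satisfies_ggi_finite_index incl_subgroup subgroup.subset[OF finite_index_step(2)] by auto
  qed
  then show ?thesis using assms by blast
qed

end

section \<open>Right vector spaces over a division ring\<close>

text \<open>Matrices act on the left, so scalars act on the right; the two actions then commute over
  a noncommutative \<open>D\<close>.\<close>

definition rscale :: "'a::division_ring ^'n \<Rightarrow> 'a \<Rightarrow> 'a ^'n" (infixl \<open>\<star>\<close> 75) where
  "v \<star> c = (\<chi> i. v $ i * c)"

lemma rscale_nth [simp]: "(v \<star> c) $ i = v $ i * c"
  by (simp add: rscale_def)

lemma rscale_simps [simp]:
  "v \<star> 0 = 0" "0 \<star> c = 0" "v \<star> 1 = v" "(- v) \<star> c = - (v \<star> c)" "v \<star> (- c) = - (v \<star> c)"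
  "v \<star> c \<star> d = v \<star> (c * d)"
  by (simp_all add: vec_eq_iff mult.assoc)

lemma rscale_distrib:
  "(v + w) \<star> c = v \<star> c + w \<star> c" "v \<star> (c + d) = v \<star> c + v \<star> d"
  "(v - w) \<star> c = v \<star> c - w \<star> c" "v \<star> (c - d) = v \<star> c - v \<star> d"
  by (simp_all add: vec_eq_iff algebra_simps)

lemma rscale_sum: "(\<Sum>k\<in>K. v k) \<star> c = (\<Sum>k\<in>K. v k \<star> c)" "w \<star> (\<Sum>k\<in>K. d k) = (\<Sum>k\<in>K. w \<star> d k)"
  by (simp_all add: vec_eq_iff sum_distrib_left sum_distrib_right)

lemma rscale_eq_0_iff [simp]: "v \<star> c = 0 \<longleftrightarrow> v = 0 \<or> c = 0"
  by (auto simp: vec_eq_iff)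

lemma mult_rscale: "A *v (x \<star> c) = (A *v x) \<star> c"
  by (simp add: vec_eq_iff matrix_vector_mult_def sum_distrib_right mult.assoc)

lemma mult_vec_add: "A *v (x + y) = A *v x + A *v (y :: 'a::division_ring ^'n)"
  by (simp add: vec_eq_iff matrix_vector_mult_def distrib_left sum.distrib)

lemma mult_vec_diff: "A *v (x - y) = A *v x - A *v (y :: 'a::division_ring ^'n)"
  by (simp add: vec_eq_iff matrix_vector_mult_def right_diff_distrib sum_subtractf)

lemma mult_vec_minus: "A *v (- x) = - (A *v (x :: 'a::division_ring ^'n))"
  by (simp add: vec_eq_iff matrix_vector_mult_def sum_negf)

lemma add_mult_vec: "(A + B) *v x = A *v x + B *v (x :: 'a::division_ring ^'n)"
  by (simp add: vec_eq_iff matrix_vector_mult_def distrib_right sum.distrib)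

lemma mult_vec_zero [simp]: "A *v 0 = (0 :: 'a::division_ring ^'n)"
  by (simp add: vec_eq_iff matrix_vector_mult_def)

lemma zero_mult_vec [simp]: "0 *v x = (0 :: 'a::division_ring ^'n)"
  by (simp add: vec_eq_iff matrix_vector_mult_def)

lemma mult_vec_sum: "A *v (\<Sum>k\<in>K. f k) = (\<Sum>k\<in>K. A *v (f k :: 'a::division_ring ^'n))"
  by (induction K rule: infinite_finite_induct) (auto simp: mult_vec_add)

lemma ring_centerD: "c \<in> ring_center \<Longrightarrow> c * x = x * c"
  by (simp add: ring_center_def)

lemma inverse_commute:
  fixes c :: "'a::division_ring"
  assumes "c * x = x * c"
  shows "inverse c * x = x * inverse c"
proof (cases "c = 0")
  case False
  have "inverse c * x = inverse c * (x * c) * inverse c" using False by (simp add: mult.assoc)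
  also have "x * c = c * x" using assms by simp
  also have "inverse c * (c * x) * inverse c = x * inverse c"
    using False by (simp add: mult.assoc[symmetric])
  finally show ?thesis .
qed simp

lemma ring_center_inverse: "c \<in> ring_center \<Longrightarrow> inverse c \<in> ring_center"
  by (simp add: ring_center_def inverse_commute)

section \<open>Linear dependence and pencils with a central parameter\<close>

lemma right_dependent:
  fixes x :: "'j \<Rightarrow> 'i \<Rightarrow> 'a::division_ring"
  assumes "finite I" "finite K" "card I < card K"
  shows "\<exists>c. (\<exists>k\<in>K. c k \<noteq> 0) \<and> (\<forall>i\<in>I. (\<Sum>k\<in>K. x k i * c k) = 0)"
  using assms
proof (induction I arbitrary: x K rule: finite_induct)
  case empty
  then have "K \<noteq> {}" by auto
  then show ?case by (intro exI[of _ "\<lambda>_. 1"]) auto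
next
  case (insert i0 I)
  show ?case
  proof (cases "\<forall>k\<in>K. x k i0 = 0")
    case True
    have "card I < card K" using insert by simp
    from insert.IH[OF insert.prems(1) this] obtain c where
      "\<exists>k\<in>K. c k \<noteq> 0" "\<forall>i\<in>I. (\<Sum>k\<in>K. x k i * c k) = 0" by blast
    then show ?thesis using True by (intro exI[of _ c]) auto
  next
    case False
    then obtain p where p: "p \<in> K" "x p i0 \<noteq> 0" by blast
    \<comment> \<open>Subtracts from each vector the right multiple of the pivot vector
      \<open>x p\<close> that clears coordinate \<open>i0\<close>. The coefficient
      \<open>d p\<close> below puts these multiples back.\<close>
    define x' where "x' k i = x k i - x p i * inverse (x p i0) * x k i0" for k i
    have "card I < card (K - {p})" using insert p by simp
    from insert.IH[OF _ this, of x'] obtain c where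
      c: "\<exists>k\<in>K - {p}. c k \<noteq> 0" "\<forall>i\<in>I. (\<Sum>k\<in>K - {p}. x' k i * c k) = 0"
      using insert.prems by auto
    define s where "s = (\<Sum>k\<in>K - {p}. x k i0 * c k)"
    define d where "d k = (if k = p then - inverse (x p i0) * s else c k)" for k
    have "(\<Sum>k\<in>K. x k i * d k) = (\<Sum>k\<in>K - {p}. x' k i * c k)" for i
    proof -
      have "(\<Sum>k\<in>K. x k i * d k) = x p i * d p + (\<Sum>k\<in>K - {p}. x k i * d k)"
        using insert.prems p by (simp add: sum.remove)
      also have "(\<Sum>k\<in>K - {p}. x k i * d k) = (\<Sum>k\<in>K - {p}. x k i * c k)"
        by (rule sum.cong) (auto simp: d_def)
      also have "x p i * d p = - (\<Sum>k\<in>K - {p}. x p i * inverse (x p i0) * x k i0 * c k)"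
        by (simp add: d_def s_def sum_distrib_left mult.assoc sum_negf)
      also have "\<dots> + (\<Sum>k\<in>K - {p}. x k i * c k) = (\<Sum>k\<in>K - {p}. x' k i * c k)"
        by (simp add: x'_def left_diff_distrib sum_subtractf)
      finally show ?thesis .
    qed
    moreover have "x' k i0 = 0" for k using p by (simp add: x'_def mult.assoc)
    ultimately have "\<forall>i\<in>insert i0 I. (\<Sum>k\<in>K. x k i * d k) = 0" using c by simp
    moreover have "\<exists>k\<in>K. d k \<noteq> 0" using c(1) by (auto simp: d_def)
    ultimately show ?thesis by blast
  qed
qed

text \<open>Take a dependency \<open>\<Sum> x \<tau> \<star> c \<tau> = 0\<close> of minimal length. Applying \<open>C\<close> to it expresses
  \<open>z \<star> (\<Sum> c \<tau> / \<tau>)\<close> through the \<open>x \<tau>\<close>; were this vector zero, subtracting the two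
  relations would give a shorter dependency.\<close>

lemma central_pencil:
  fixes x :: "'a::division_ring \<Rightarrow> 'k \<Rightarrow> 'a ^'n" and C :: "('k \<Rightarrow> 'a ^'n) \<Rightarrow> 'k \<Rightarrow> 'a ^'n"
  assumes I: "finite I" and T: "T \<subseteq> ring_center" "infinite T" "0 \<notin> T"
    and lin: "\<And>K (W :: 'a \<Rightarrow> _) c s. finite K \<Longrightarrow> s \<in> I \<Longrightarrow>
      C (\<lambda>s. \<Sum>\<tau>\<in>K. W \<tau> s \<star> c \<tau>) s = (\<Sum>\<tau>\<in>K. C (W \<tau>) s \<star> (c \<tau> :: 'a))"
    and loc: "\<And>W Y s. (\<And>s. s \<in> I \<Longrightarrow> W s = Y s) \<Longrightarrow> s \<in> I \<Longrightarrow> C W s = C Y s"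
    and eq: "\<And>\<tau> s. \<tau> \<in> T \<Longrightarrow> s \<in> I \<Longrightarrow> x \<tau> s = z s + C (x \<tau>) s \<star> \<tau>"
    and nz: "\<And>\<tau>. \<tau> \<in> T \<Longrightarrow> \<exists>s\<in>I. x \<tau> s \<noteq> 0"
  obtains K c where "finite K" "K \<subseteq> T" "\<And>s. s \<in> I \<Longrightarrow> z s = (\<Sum>\<tau>\<in>K. x \<tau> s \<star> c \<tau>)" "\<exists>s\<in>I. z s \<noteq> 0"
proof -
  define dep where "dep K c \<longleftrightarrow> finite K \<and> K \<subseteq> T \<and> (\<exists>k\<in>K. c k \<noteq> 0) \<and>
    (\<forall>s\<in>I. (\<Sum>\<tau>\<in>K. x \<tau> s \<star> c \<tau>) = 0)" for K c
  obtain K0 where K0: "finite K0" "card K0 = Suc (card (I \<times> (UNIV :: 'n set)))" "K0 \<subseteq> T"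
    using infinite_arbitrarily_large[OF T(2)] by metis
  have "\<exists>c. (\<exists>k\<in>K0. c k \<noteq> 0) \<and> (\<forall>i\<in>I \<times> (UNIV :: 'n set). (\<Sum>k\<in>K0. (x k (fst i) $ snd i) * c k) = 0)"
    by (rule right_dependent) (use I K0 in auto)
  then obtain c0 where "\<exists>k\<in>K0. c0 k \<noteq> 0" "\<forall>s\<in>I. \<forall>i. (\<Sum>k\<in>K0. (x k s $ i) * c0 k) = 0" by auto
  then have "dep K0 c0" unfolding dep_def using K0 by (simp add: vec_eq_iff)
  then have "\<exists>n K c. dep K c \<and> card K = n" by blast
  then obtain K c where K: "dep K c" and min: "\<And>K' c'. dep K' c' \<Longrightarrow> card K \<le> card K'"
    using exists_least_iff[of "\<lambda>n. \<exists>K c. dep K c \<and> card K = n"] by (metis not_le)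
  obtain \<sigma> where \<sigma>: "\<sigma> \<in> K" "c \<sigma> \<noteq> 0" using K unfolding dep_def by blast
  have fin: "finite K" and KT: "K \<subseteq> T" and sum0: "\<And>s. s \<in> I \<Longrightarrow> (\<Sum>\<tau>\<in>K. x \<tau> s \<star> c \<tau>) = 0"
    using K unfolding dep_def by auto
  have nonzero: "\<tau> \<noteq> 0" if "\<tau> \<in> K" for \<tau> using that KT T by auto
  define e where "e = (\<Sum>\<tau>\<in>K. inverse \<tau> * c \<tau>)"
  have Cx: "C (x \<tau>) s = (x \<tau> s - z s) \<star> inverse \<tau>" if "\<tau> \<in> K" "s \<in> I" for \<tau> s
    using eq[of \<tau> s] that KT nonzero[OF that(1)] by (auto simp: subset_iff)
  have rel: "(\<Sum>\<tau>\<in>K. x \<tau> s \<star> (inverse \<tau> * c \<tau>)) = z s \<star> e" if s: "s \<in> I" for s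
  proof -
    have "C (\<lambda>s. \<Sum>\<tau>\<in>K. x \<tau> s \<star> c \<tau>) s = C (\<lambda>s. \<Sum>\<tau>\<in>{}. x \<tau> s \<star> c \<tau>) s"
      by (rule loc) (use sum0 s in auto)
    also have "\<dots> = 0" using lin[of "{}" s x c] s by simp
    finally have "(\<Sum>\<tau>\<in>K. (x \<tau> s - z s) \<star> (inverse \<tau> * c \<tau>)) = 0"
      using lin[OF fin s, of x c] Cx s by simp
    then show ?thesis by (simp add: rscale_distrib sum_subtractf e_def rscale_sum)
  qed
  have "\<exists>s\<in>I. z s \<star> e \<noteq> 0"
  proof (rule ccontr)
    assume "\<not> ?thesis"
    then have zero: "(\<Sum>\<tau>\<in>K. x \<tau> s \<star> (inverse \<tau> * c \<tau>)) = 0" if "s \<in> I" for s using rel that by auto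
    define c' where "c' \<tau> = (inverse \<tau> - inverse \<sigma>) * c \<tau>" for \<tau>
    have "(\<Sum>\<tau>\<in>K - {\<sigma>}. x \<tau> s \<star> c' \<tau>) = 0" if s: "s \<in> I" for s
    proof -
      have "inverse \<sigma> \<in> ring_center" using \<sigma> KT T ring_center_inverse by blast
      then have "x \<tau> s \<star> (inverse \<sigma> * c \<tau>) = x \<tau> s \<star> c \<tau> \<star> inverse \<sigma>" for \<tau>
        using ring_centerD[of "inverse \<sigma>" "c \<tau>"] by simp
      then have "(\<Sum>\<tau>\<in>K. x \<tau> s \<star> (inverse \<sigma> * c \<tau>)) = (\<Sum>\<tau>\<in>K. x \<tau> s \<star> c \<tau>) \<star> inverse \<sigma>"
        by (simp only: rscale_sum)
      then have "(\<Sum>\<tau>\<in>K. x \<tau> s \<star> c' \<tau>) = 0"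
        using zero[OF s] sum0[OF s] by (simp add: c'_def left_diff_distrib rscale_distrib sum_subtractf)
      moreover have "c' \<sigma> = 0" by (simp add: c'_def)
      ultimately show ?thesis using fin \<sigma> by (simp add: sum.remove)
    qed
    moreover have "card (K - {\<sigma>}) < card K" by (rule card_Diff1_less[OF fin \<sigma>(1)])
    \<comment> \<open>By minimality the shorter relation is trivial. As
      \<open>inverse \<tau>\<close> differs from \<open>inverse \<sigma>\<close>, the original
      relation is supported at \<sigma> alone, which contradicts \<open>nz\<close>.\<close>
    ultimately have "\<forall>\<tau>\<in>K - {\<sigma>}. c' \<tau> = 0"
      using min[of "K - {\<sigma>}" c'] fin KT unfolding dep_def by (meson Diff_subset finite_Diff leD subset_trans)
    then have "\<forall>\<tau>\<in>K - {\<sigma>}. c \<tau> = 0" by (auto simp: c'_def)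
    then have "x \<sigma> s \<star> c \<sigma> = 0" if "s \<in> I" for s
      using sum0[OF that] fin \<sigma>(1) by (simp add: sum.remove)
    then show False using nz[of \<sigma>] \<sigma> KT by auto
  qed
  then have e: "e \<noteq> 0" and z: "\<exists>s\<in>I. z s \<noteq> 0" by auto
  show thesis
  proof (rule that[OF fin KT _ z])
    fix s assume s: "s \<in> I"
    have "z s = z s \<star> e \<star> inverse e" using e by simp
    also have "\<dots> = (\<Sum>\<tau>\<in>K. x \<tau> s \<star> (inverse \<tau> * c \<tau> * inverse e))"
      by (simp only: rel[OF s, symmetric] rscale_sum) (simp add: mult.assoc)
    finally show "z s = (\<Sum>\<tau>\<in>K. x \<tau> s \<star> (inverse \<tau> * c \<tau> * inverse e))" .
  qed
qed

text \<open>The columns of \<open>A\<close> together with a basis vector are n + 1 vectors, hence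
  dependent; injectivity keeps the coefficient of the basis vector from vanishing. This gives a
  right inverse, and injectivity makes it two-sided.\<close>

lemma matrix_injective_imp_invertible:
  fixes A :: "'a::division_ring ^'n^'n"
  assumes inj: "\<And>x. A *v x = 0 \<Longrightarrow> x = 0"
  shows "A \<in> carrier GL_mat"
proof -
  have "\<exists>b. A *v b = axis i 1" for i
  proof -
    define x :: "'n option \<Rightarrow> 'n \<Rightarrow> 'a" where
      "x k j = (case k of None \<Rightarrow> axis i 1 $ j | Some l \<Rightarrow> A $ j $ l)" for k j
    have "\<exists>c. (\<exists>k\<in>UNIV. c k \<noteq> 0) \<and> (\<forall>j\<in>UNIV. (\<Sum>k\<in>UNIV. x k j * c k) = 0)"
      by (rule right_dependent) (auto simp: card_UNIV_option)
    then obtain c where c: "\<exists>k. c k \<noteq> 0" "\<And>j. (\<Sum>k\<in>UNIV. x k j * c k) = 0" by auto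
    define v where "v = (\<chi> l. c (Some l))"
    have "(\<Sum>k\<in>UNIV. x k j * c k) = (axis i 1 \<star> c None + A *v v) $ j" for j
      unfolding UNIV_option_conv
      by (simp add: sum.reindex x_def matrix_vector_mult_def v_def)
    then have eq: "axis i 1 \<star> c None + A *v v = 0" using c(2) by (simp add: vec_eq_iff)
    have "c None \<noteq> 0"
    proof
      assume 0: "c None = 0"
      then have "v = 0" using eq inj by simp
      then have "c k = 0" for k using 0 by (cases k) (auto simp: v_def vec_eq_iff)
      then show False using c(1) by blast
    qed
    then have "A *v (v \<star> (- inverse (c None))) = axis i 1"
      using eq by (simp add: mult_rscale mult_vec_minus add_eq_0_iff)
    then show ?thesis by blast
  qed
  then obtain b where b: "\<And>i. A *v b i = axis i 1" by metis
  define B where "B = (\<chi> k i. b i $ k)"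
  have AB: "A ** B = mat 1"
  proof -
    have "(A ** B) $ j $ i = (A *v b i) $ j" for i j
      by (simp add: matrix_matrix_mult_def matrix_vector_mult_def B_def)
    then show ?thesis by (simp add: b vec_eq_iff mat_def axis_def)
  qed
  have "(B ** A) *v x = x" for x
  proof -
    have "A *v ((B ** A) *v x - x) = 0"
      by (simp add: mult_vec_diff matrix_vector_mul_assoc matrix_mul_assoc AB)
    then show ?thesis using inj by (metis eq_iff_diff_eq_0)
  qed
  then have "B ** A = mat 1" by (simp add: matrix_eq)
  with AB show ?thesis by (auto simp: GL_mat_def)
qed

definition mscale :: "'a::division_ring ^'n^'n \<Rightarrow> 'a \<Rightarrow> 'a ^'n^'n" where
  "mscale Y c = (\<chi> i j. Y $ i $ j * c)"

lemma mscale_mult_vec: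
  assumes "c \<in> ring_center"
  shows "mscale Y c *v x = (Y *v x) \<star> c"
proof -
  have "c * x $ j = x $ j * c" for j by (rule ring_centerD[OF assms])
  then show ?thesis
    by (simp add: vec_eq_iff mscale_def matrix_vector_mult_def sum_distrib_right mult.assoc)
qed

text \<open>Kernel vectors for distinct nonzero \<tau> are eigenvectors of \<open>Y\<close> for
  distinct central eigenvalues. This is the homogeneous case z = 0 of \<open>central_pencil\<close>,
  whose conclusion that z is nonzero is then absurd.\<close>

lemma finite_singular:
  fixes Y :: "'a::division_ring ^'n^'n"
  shows "finite {\<tau> \<in> ring_center. mat 1 + mscale Y \<tau> \<notin> carrier GL_mat}"
proof (rule ccontr)
  define T where "T = {\<tau> \<in> ring_center. mat 1 + mscale Y \<tau> \<notin> carrier GL_mat} - {0}"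
  assume "infinite {\<tau> \<in> ring_center. mat 1 + mscale Y \<tau> \<notin> carrier GL_mat}"
  then have T: "infinite T" "T \<subseteq> ring_center" "0 \<notin> T" unfolding T_def by auto
  have "\<exists>x. x \<noteq> 0 \<and> x + (Y *v x) \<star> \<tau> = 0" if "\<tau> \<in> T" for \<tau>
  proof -
    have \<tau>: "\<tau> \<in> ring_center" and ns: "mat 1 + mscale Y \<tau> \<notin> carrier GL_mat"
      using that by (auto simp: T_def)
    obtain x where "(mat 1 + mscale Y \<tau>) *v x = 0" "x \<noteq> 0"
      using matrix_injective_imp_invertible[of "mat 1 + mscale Y \<tau>"] ns by blast
    then show ?thesis using \<tau> by (auto simp: add_mult_vec mscale_mult_vec)
  qed
  then obtain x where x: "\<And>\<tau>. \<tau> \<in> T \<Longrightarrow> x \<tau> \<noteq> 0 \<and> x \<tau> + (Y *v x \<tau>) \<star> \<tau> = 0" by metis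
  obtain K c where "\<exists>s\<in>{()}. (\<lambda>_. 0 :: 'a ^'n) s \<noteq> 0"
  proof (rule central_pencil[of "{()}" T "\<lambda>W s. - (Y *v W s)" "\<lambda>\<tau> _. x \<tau>" "\<lambda>_. 0"])
    show "x \<tau> = 0 + - (Y *v x \<tau>) \<star> \<tau>" if "\<tau> \<in> T" for \<tau> s
      using x[OF that] by (simp add: eq_neg_iff_add_eq_0)
    show "\<exists>s\<in>{()}. x \<tau> \<noteq> 0" if "\<tau> \<in> T" for \<tau>
      using x[OF that] by simp
    show "- (Y *v (\<Sum>\<tau>\<in>K. W \<tau> s \<star> c \<tau>)) = (\<Sum>\<tau>\<in>K. - (Y *v W \<tau> s) \<star> c \<tau>)" for K W c s
      by (simp add: mult_vec_sum mult_rscale sum_negf)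
  qed (use T in auto)
  then show False by simp
qed

section \<open>Formal expansion of a word along \<open>x\<^sub>i = 1 + t y\<^sub>i\<close>\<close>

text \<open>The coefficients of \<open>(1 + t y)\<^sup>-\<^sup>1 b(t)\<close> for a power series
  b(t); \<open>linear_factor\<close> gives those of \<open>(1 + t y) b(t)\<close>.\<close>

fun geometric :: "('v::ab_group_add \<Rightarrow> 'v) \<Rightarrow> (nat \<Rightarrow> 'v) \<Rightarrow> nat \<Rightarrow> 'v" where
  "geometric y b 0 = b 0"
| "geometric y b (Suc k) = b (Suc k) - y (geometric y b k)"

definition linear_factor :: "('v::ab_group_add \<Rightarrow> 'v) \<Rightarrow> (nat \<Rightarrow> 'v) \<Rightarrow> nat \<Rightarrow> 'v" where
  "linear_factor y b k = (case k of 0 \<Rightarrow> b 0 | Suc k' \<Rightarrow> b (Suc k') + y (b k'))"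

lemma linear_factor_simps [simp]:
  "linear_factor y b 0 = b 0" "linear_factor y b (Suc k) = b (Suc k) + y (b k)"
  by (simp_all add: linear_factor_def)

text \<open>\<open>expansion ws l y z k\<close> is the coefficient of \<open>t\<^sup>k\<close> in the power series obtained by applying
  the word \<open>ws\<close> at \<open>x\<^sub>i = 1 + t y\<^sub>i\<close> to the vector \<open>z\<close>; the \<open>y\<^sub>i\<close> are arbitrary operators.
  Exponents other than \<open>1\<close> are read as \<open>- 1\<close>.\<close>

fun expansion :: "(('a::division_ring ^'n^'n) \<times> nat \<times> int) list \<Rightarrow> 'a ^'n^'n \<Rightarrow>
    (nat \<Rightarrow> 'a ^'n \<Rightarrow> 'a ^'n) \<Rightarrow> 'a ^'n \<Rightarrow> nat \<Rightarrow> 'a ^'n" where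
  "expansion [] l y z k = (if k = 0 then l *v z else 0)"
| "expansion ((A, i, \<alpha>) # ws) l y z k =
     A *v (if \<alpha> = 1 then linear_factor else geometric) (y i) (expansion ws l y z) k"

lemma GL_mat_simps [simp]: "A \<otimes>\<^bsub>GL_mat\<^esub> B = A ** B" "\<one>\<^bsub>GL_mat\<^esub> = mat 1"
  by (simp_all add: GL_mat_def)

lemma group_GL_mat: "group (GL_mat :: ('a::division_ring ^'n^'n) monoid)"
proof (rule groupI)
  fix A B :: "'a ^'n^'n" assume "A \<in> carrier GL_mat" "B \<in> carrier GL_mat"
  then obtain A' B' where AB: "A ** A' = mat 1" "A' ** A = mat 1" "B ** B' = mat 1" "B' ** B = mat 1"
    by (auto simp: GL_mat_def)
  have "A ** B ** (B' ** A') = A ** (B ** B') ** A'" by (simp only: matrix_mul_assoc)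
  moreover have "B' ** A' ** (A ** B) = B' ** (A' ** A) ** B" by (simp only: matrix_mul_assoc)
  ultimately show "A \<otimes>\<^bsub>GL_mat\<^esub> B \<in> carrier GL_mat" using AB by (auto simp: GL_mat_def)
qed (auto simp: GL_mat_def matrix_mul_assoc)

lemma GL_inverse:
  fixes A :: "'a::division_ring ^'n^'n"
  assumes "A \<in> carrier GL_mat"
  shows "inv\<^bsub>GL_mat\<^esub> A ** A = mat 1" "A ** inv\<^bsub>GL_mat\<^esub> A = mat 1" "inv\<^bsub>GL_mat\<^esub> A \<in> carrier GL_mat"
  using group.l_inv[OF group_GL_mat assms] group.r_inv[OF group_GL_mat assms]
    group.inv_closed[OF group_GL_mat assms] by simp_all

text \<open>\<open>step\<close> acts on families of vectors indexed by the suffixes of a word and turns the values of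
  all suffixes at \<open>x\<^sub>i = 1 + \<tau> y\<^sub>i\<close> into the solution of an equation linear in \<open>\<tau>\<close>. The inverse
  \<open>A\<^sup>-\<^sup>1\<close> recovers the vector before the multiplication by \<open>A\<close>.\<close>

fun step :: "(nat \<Rightarrow> 'a ^'n \<Rightarrow> 'a ^'n) \<Rightarrow> ((('a::division_ring ^'n^'n) \<times> nat \<times> int) list \<Rightarrow> 'a ^'n) \<Rightarrow>
    (('a ^'n^'n) \<times> nat \<times> int) list \<Rightarrow> 'a ^'n" where
  "step y W [] = 0"
| "step y W ((A, i, \<alpha>) # ws) = A *v step y W ws +
    (if \<alpha> = 1 then A *v y i (W ws)
     else - (A *v y i (inv\<^bsub>GL_mat\<^esub> A *v W ((A, i, \<alpha>) # ws))))"

text \<open>In terms of power series this says V = V(0) + t step(V) for the family V of the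
  expansions of all suffixes. For an inverse factor it is the identity \<open>(1 + t
  y)\<^sup>-\<^sup>1 b = b - t y (1 + t y)\<^sup>-\<^sup>1 b\<close>.\<close>

lemma expansion_Suc:
  assumes "\<forall>(A, i, \<alpha>) \<in> set ws. A \<in> carrier GL_mat"
  shows "expansion ws l y z (Suc k) = step y (\<lambda>s. expansion s l y z k) ws"
  using assms
proof (induction ws)
  case (Cons w ws)
  obtain A i \<alpha> where w: "w = (A, i, \<alpha>)" by (cases w) auto
  have A: "inv\<^bsub>GL_mat\<^esub> A ** A = mat 1" using GL_inverse(1)[of A] Cons.prems w by auto
  have "expansion ws l y z (Suc k) = step y (\<lambda>s. expansion s l y z k) ws" using Cons by auto
  then show ?case
    by (simp add: w mult_vec_add mult_vec_diff matrix_vector_mul_assoc A)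
qed simp

lemma step_cong:
  assumes "\<And>s. suffix s ws \<Longrightarrow> W s = W' s"
  shows "step y W ws = step y W' ws"
  using assms
proof (induction ws)
  case (Cons w ws)
  then have "step y W ws = step y W' ws" by (simp add: suffix_ConsI)
  then show ?case using Cons.prems[of "w # ws"] Cons.prems[of ws]
    by (cases w) (simp add: suffix_ConsI)
qed simp

lemma step_sum:
  assumes "finite K"
  shows "step (\<lambda>i x. Y i *v x) (\<lambda>s. \<Sum>\<tau>\<in>K. W \<tau> s \<star> c \<tau>) ws =
    (\<Sum>\<tau>\<in>K. step (\<lambda>i x. Y i *v x) (W \<tau>) ws \<star> c \<tau>)"
proof (induction ws)
  case (Cons w ws)
  then show ?case
    by (cases w) (simp add: mult_vec_sum mult_rscale rscale_distrib sum.distrib sum_negf)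
qed simp

definition word_value :: "(('a::division_ring ^'n^'n) \<times> nat \<times> int) list \<Rightarrow> 'a ^'n^'n \<Rightarrow>
    (nat \<Rightarrow> 'a ^'n^'n) \<Rightarrow> 'a ^'n \<Rightarrow> 'a \<Rightarrow> 'a ^'n" where
  "word_value ws l Y z \<tau> = eval_monomial GL_mat ws l (\<lambda>i. mat 1 + mscale (Y i) \<tau>) *v z"

text \<open>The actual values at a central \<tau> satisfy the same equation as the formal series in
  \<open>expansion_Suc\<close>, with \<tau> in place of t. The \<open>y\<close> in the constant term
  is arbitrary because degree zero does not see it.\<close>

lemma word_value_eq_step:
  fixes Y :: "nat \<Rightarrow> 'a::division_ring ^'n^'n"
  assumes \<tau>: "\<tau> \<in> ring_center" "\<And>i. mat 1 + mscale (Y i) \<tau> \<in> carrier GL_mat"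
    and ws: "\<forall>(A, i, \<alpha>) \<in> set ws. A \<in> carrier GL_mat \<and> \<bar>\<alpha>\<bar> = 1"
  shows "word_value ws l Y z \<tau> = expansion ws l y z 0 +
    step (\<lambda>i x. Y i *v x) (\<lambda>s. word_value s l Y z \<tau>) ws \<star> \<tau>"
  using ws
proof (induction ws)
  case (Cons w ws)
  interpret GL: group "GL_mat :: ('a ^'n^'n) monoid" by (rule group_GL_mat)
  obtain A i \<alpha> where w: "w = (A, i, \<alpha>)" by (cases w) auto
  have A: "A \<in> carrier GL_mat" "\<bar>\<alpha>\<bar> = 1" using Cons.prems w by auto
  let ?c = "mat 1 + mscale (Y i) \<tau>"
  let ?v = "\<lambda>s. word_value s l Y z \<tau>"
  have IH: "?v ws = expansion ws l y z 0 + step (\<lambda>i x. Y i *v x) ?v ws \<star> \<tau>" using Cons by auto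
  have c: "?c *v x = x + (Y i *v x) \<star> \<tau>" for x
    using \<tau>(1) by (simp add: add_mult_vec mscale_mult_vec)
  have AIH: "A *v ?v ws = A *v expansion ws l y z 0 + (A *v step (\<lambda>i x. Y i *v x) ?v ws) \<star> \<tau>"
    by (subst IH) (simp add: mult_vec_add mult_rscale)
  consider "\<alpha> = 1" | "\<alpha> = - 1" using A(2) by linarith
  then show ?case
  proof cases
    case 1
    have "?v (w # ws) = A *v (?c *v ?v ws)"
      unfolding word_value_def using 1 \<tau>(2) w by (simp add: matrix_vector_mul_assoc matrix_mul_assoc)
    then have "?v (w # ws) = A *v ?v ws + (A *v (Y i *v ?v ws)) \<star> \<tau>"
      by (simp add: c mult_vec_add mult_rscale)
    then show ?thesis unfolding AIH using w 1 by (simp add: rscale_distrib)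
  next
    case 2
    define u where "u = inv\<^bsub>GL_mat\<^esub> ?c *v ?v ws"
    have v: "?v (w # ws) = A *v u"
      unfolding word_value_def u_def using 2 \<tau>(2) w
      by (simp add: matrix_vector_mul_assoc matrix_mul_assoc GL.int_pow_neg)
    have "?c *v u = ?v ws"
      unfolding u_def using GL_inverse(2)[OF \<tau>(2)] by (simp add: matrix_vector_mul_assoc)
    then have u: "u = ?v ws - (Y i *v u) \<star> \<tau>" unfolding c by (simp add: algebra_simps)
    have "inv\<^bsub>GL_mat\<^esub> A *v ?v (w # ws) = u"
      using GL_inverse(1)[OF A(1)] v by (simp add: matrix_vector_mul_assoc)
    then have step: "step (\<lambda>i x. Y i *v x) ?v (w # ws)
        = A *v step (\<lambda>i x. Y i *v x) ?v ws - A *v (Y i *v u)"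
      using 2 w by simp
    have "A *v u = A *v (?v ws - (Y i *v u) \<star> \<tau>)" using u by simp
    then have "?v (w # ws) = A *v ?v ws - (A *v (Y i *v u)) \<star> \<tau>"
      unfolding v by (simp add: mult_vec_diff mult_rscale)
    then show ?thesis unfolding AIH step using w 2 by (simp add: rscale_distrib)
  qed
qed (simp add: word_value_def)

text \<open>Every formal coefficient is a combination of finitely many values
  \<open>v \<tau> s\<close>, with scalars \<open>d \<tau>\<close> common to all suffixes
  \<open>s\<close>. The empty suffix has constant value \<open>l *v z\<close> and no higher
  coefficients, so these scalars add up to 0. By the identity the full word has constant value
  \<open>z\<close>, so its coefficient is \<open>z\<close> times the same sum.\<close>

lemma expansion_eq_0_matrices:
  fixes Y :: "nat \<Rightarrow> 'a::division_ring ^'n^'n"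
  assumes inf: "infinite (ring_center :: 'a set)"
    and ws: "\<forall>(A, i, \<alpha>) \<in> set ws. A \<in> carrier GL_mat \<and> \<bar>\<alpha>\<bar> = 1" and l: "l \<in> carrier GL_mat"
    and id: "\<And>c. (\<forall>i. c i \<in> carrier GL_mat) \<Longrightarrow> eval_monomial GL_mat ws l c = mat 1"
    and J: "finite J" "\<And>i. i \<notin> J \<Longrightarrow> Y i = 0"
  shows "expansion ws l (\<lambda>i x. Y i *v x) z (Suc k) = 0"
proof (cases "z = 0")
  case True
  have "expansion ws l (\<lambda>i x. Y i *v x) 0 k = 0" for k
  proof (induction ws arbitrary: k)
    case (Cons w ws)
    have "geometric (\<lambda>x. Y i *v x) (expansion ws l (\<lambda>i x. Y i *v x) 0) k = 0" for i k
      by (induction k) (simp_all add: Cons)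
    moreover have "linear_factor (\<lambda>x. Y i *v x) (expansion ws l (\<lambda>i x. Y i *v x) 0) k = 0" for i k
      by (cases k) (simp_all add: Cons)
    ultimately show ?case by (cases w) auto
  qed simp
  then show ?thesis using True by simp
next
  case False
  let ?y = "\<lambda>i x. Y i *v x"
  \<comment> \<open>Only the finitely many \<open>i\<close> in \<open>J\<close> can produce a
    singular factor, so \<open>B\<close> is a finite union of finite sets.\<close>
  define B where "B = (\<Union>i\<in>J. {\<tau> \<in> ring_center. mat 1 + mscale (Y i) \<tau> \<notin> carrier GL_mat})"
  define T where "T = ring_center - (B \<union> {0})"
  have "finite B" unfolding B_def using J(1) finite_singular by blast
  then have T: "infinite T" "T \<subseteq> ring_center" "0 \<notin> T" using inf unfolding T_def by auto
  have one: "mat 1 \<in> carrier GL_mat" by (auto simp: GL_mat_def)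
  have reg: "mat 1 + mscale (Y i) \<tau> \<in> carrier GL_mat" if "\<tau> \<in> T" for \<tau> i
  proof (cases "i \<in> J")
    case False
    then have "mscale (Y i) \<tau> = 0" using J(2) by (simp add: mscale_def vec_eq_iff)
    then show ?thesis using one by simp
  qed (use that in \<open>auto simp: T_def B_def\<close>)
  define I where "I = {s. suffix s ws}"
  have I: "finite I" "ws \<in> I" "[] \<in> I" unfolding I_def set_suffixes_eq[symmetric] by auto
  have sub: "\<forall>(A, i, \<alpha>) \<in> set s. A \<in> carrier GL_mat \<and> \<bar>\<alpha>\<bar> = 1" if "s \<in> I" for s
    using ws that unfolding I_def by (meson mem_Collect_eq set_mono_suffix subsetD)
  define v where "v \<tau> s = word_value s l Y z \<tau>" for \<tau> s
  have v: "v \<tau> s = expansion s l ?y z 0 + step ?y (v \<tau>) s \<star> \<tau>" if "\<tau> \<in> T" "s \<in> I" for \<tau> s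
    unfolding v_def by (rule word_value_eq_step) (use that T reg sub in auto)
  have lz: "l *v z \<noteq> 0"
  proof
    assume "l *v z = 0"
    then have "inv\<^bsub>GL_mat\<^esub> l *v (l *v z) = 0" by simp
    then show False using GL_inverse(1)[OF l] False by (simp add: matrix_vector_mul_assoc)
  qed
  have cong: "step ?y W s = step ?y W' s" if "\<And>s. s \<in> I \<Longrightarrow> W s = W' s" "s \<in> I" for W W' s
  proof (rule step_cong)
    fix s' assume "suffix s' s"
    then have "s' \<in> I" using that(2) suffix_order.trans unfolding I_def by blast
    then show "W s' = W' s'" by (rule that(1))
  qed
  have "\<exists>K c. finite K \<and> K \<subseteq> T \<and> (\<forall>s\<in>I. expansion s l ?y z 0 = (\<Sum>\<tau>\<in>K. v \<tau> s \<star> c \<tau>))"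
    (is ?ex)
  proof (rule central_pencil[OF I(1) T(2,1,3), of "step ?y" v "\<lambda>s. expansion s l ?y z 0"])
    show "\<exists>s\<in>I. v \<tau> s \<noteq> 0" if "\<tau> \<in> T" for \<tau>
      using I(3) lz by (intro bexI[of _ "[]"]) (auto simp: v_def word_value_def)
    show "v \<tau> s = expansion s l ?y z 0 + step ?y (v \<tau>) s \<star> \<tau>" if "\<tau> \<in> T" "s \<in> I" for \<tau> s
      by (rule v[OF that])
    show "step ?y W s = step ?y W' s" if "\<And>s. s \<in> I \<Longrightarrow> W s = W' s" "s \<in> I" for W W' s
      by (rule cong[OF that])
    show "step ?y (\<lambda>s. \<Sum>\<tau>\<in>K. W \<tau> s \<star> c \<tau>) s = (\<Sum>\<tau>\<in>K. step ?y (W \<tau>) s \<star> c \<tau>)"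
      if "finite K" for K c s and W :: "'a \<Rightarrow> _"
      by (rule step_sum[OF that])
    show "?ex" if "finite K" "K \<subseteq> T" "\<And>s. s \<in> I \<Longrightarrow> expansion s l ?y z 0 = (\<Sum>\<tau>\<in>K. v \<tau> s \<star> c \<tau>)" for K c
      using that by blast
  qed
  then obtain K c where K: "finite K" "K \<subseteq> T"
    and c: "\<And>s. s \<in> I \<Longrightarrow> expansion s l ?y z 0 = (\<Sum>\<tau>\<in>K. v \<tau> s \<star> c \<tau>)" by blast
  have span: "\<exists>d. \<forall>s\<in>I. expansion s l ?y z k = (\<Sum>\<tau>\<in>K. v \<tau> s \<star> d \<tau>)" for k
  proof (induction k)
    case (Suc k)
    then obtain d where "\<forall>s\<in>I. expansion s l ?y z k = (\<Sum>\<tau>\<in>K. v \<tau> s \<star> d \<tau>)" ..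
    then have d: "\<And>s. s \<in> I \<Longrightarrow> expansion s l ?y z k = (\<Sum>\<tau>\<in>K. v \<tau> s \<star> d \<tau>)" by simp
    \<comment> \<open>The equation for the values turns \<open>step\<close> of
      \<open>v \<tau>\<close> into
      \<open>(v \<tau> - expansion s l ?y z 0) \<star> inverse \<tau>\<close>. The constant terms
      collect into one multiple by \<open>e\<close> and are rewritten through the values by
      \<open>c\<close>.\<close>
    define e where "e = (\<Sum>\<tau>\<in>K. inverse \<tau> * d \<tau>)"
    have "expansion s l ?y z (Suc k) = (\<Sum>\<tau>\<in>K. v \<tau> s \<star> (inverse \<tau> * d \<tau> - c \<tau> * e))" if s: "s \<in> I" for s
    proof -
      have "expansion s l ?y z (Suc k) = step ?y (\<lambda>s. expansion s l ?y z k) s"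
        by (rule expansion_Suc) (use sub[OF s] in auto)
      also have "\<dots> = step ?y (\<lambda>s. \<Sum>\<tau>\<in>K. v \<tau> s \<star> d \<tau>) s" by (rule cong) (use d s in auto)
      also have "\<dots> = (\<Sum>\<tau>\<in>K. step ?y (v \<tau>) s \<star> d \<tau>)" by (rule step_sum[OF K(1)])
      also have "\<dots> = (\<Sum>\<tau>\<in>K. (v \<tau> s - expansion s l ?y z 0) \<star> (inverse \<tau> * d \<tau>))"
      proof (rule sum.cong[OF refl])
        fix \<tau> assume "\<tau> \<in> K"
        then have \<tau>: "\<tau> \<in> T" "\<tau> \<noteq> 0" using K(2) T(3) by auto
        have "v \<tau> s - expansion s l ?y z 0 = step ?y (v \<tau>) s \<star> \<tau>" using v[OF \<tau>(1) s] by simp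
        then have "(v \<tau> s - expansion s l ?y z 0) \<star> inverse \<tau> \<star> d \<tau> = step ?y (v \<tau>) s \<star> d \<tau>"
          using \<tau>(2) by simp
        then show "step ?y (v \<tau>) s \<star> d \<tau> = (v \<tau> s - expansion s l ?y z 0) \<star> (inverse \<tau> * d \<tau>)" by simp
      qed
      also have "\<dots> = (\<Sum>\<tau>\<in>K. v \<tau> s \<star> (inverse \<tau> * d \<tau>)) - expansion s l ?y z 0 \<star> e"
        by (simp add: rscale_distrib sum_subtractf e_def rscale_sum)
      also have "expansion s l ?y z 0 \<star> e = (\<Sum>\<tau>\<in>K. v \<tau> s \<star> (c \<tau> * e))"
        unfolding c[OF s] by (simp add: rscale_sum)
      finally show ?thesis by (simp add: rscale_distrib sum_subtractf)
    qed
    then show ?case by (intro exI[of _ "\<lambda>\<tau>. inverse \<tau> * d \<tau> - c \<tau> * e"] ballI)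
  next
    case 0
    show ?case by (intro exI[of _ c] ballI) (rule c)
  qed
  obtain d where "\<forall>s\<in>I. expansion s l ?y z (Suc k) = (\<Sum>\<tau>\<in>K. v \<tau> s \<star> d \<tau>)"
    using span[of "Suc k"] ..
  then have d: "\<And>s. s \<in> I \<Longrightarrow> expansion s l ?y z (Suc k) = (\<Sum>\<tau>\<in>K. v \<tau> s \<star> d \<tau>)" by simp
  have "(l *v z) \<star> (\<Sum>\<tau>\<in>K. d \<tau>) = expansion [] l ?y z (Suc k)"
    using d[OF I(3)] by (simp add: v_def word_value_def rscale_sum)
  then have "(\<Sum>\<tau>\<in>K. d \<tau>) = 0" using lz by simp
  moreover have "v \<tau> ws = z" if "\<tau> \<in> K" for \<tau>
    unfolding v_def word_value_def using id[of "\<lambda>i. mat 1 + mscale (Y i) \<tau>"] reg that K(2) by auto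
  then have "expansion ws l ?y z (Suc k) = z \<star> (\<Sum>\<tau>\<in>K. d \<tau>)"
    using d[OF I(2)] by (simp add: rscale_sum)
  ultimately show ?thesis by simp
qed

section \<open>Extension of scalars by a commuting element\<close>

text \<open>Horner's scheme. Only the argument \<sigma> has to be central, so that it commutes with
  \<sigma> - \<sigma>0. The last clause records the leading coefficient, from which
  \<open>central_polynomial_eq_0\<close> reads off that the degree drops.\<close>

lemma central_synthetic_division:
  fixes c :: "nat \<Rightarrow> 'a::division_ring ^'n"
  shows "\<exists>d r. (\<forall>\<sigma>\<in>ring_center. (\<Sum>l<Suc N. c l \<star> \<sigma> ^ l) = (\<Sum>l<N. d l \<star> \<sigma> ^ l) \<star> (\<sigma> - \<sigma>0) + r) \<and>
    (if N = 0 then r = c 0 else d (N - 1) = c N)"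
proof (induction N arbitrary: c)
  case 0
  show ?case by (rule exI, rule exI[of _ "c 0"]) simp
next
  case (Suc N)
  obtain d r where dr: "\<And>\<sigma>. \<sigma> \<in> ring_center \<Longrightarrow>
      (\<Sum>l<Suc N. c (Suc l) \<star> \<sigma> ^ l) = (\<Sum>l<N. d l \<star> \<sigma> ^ l) \<star> (\<sigma> - \<sigma>0) + r"
    "if N = 0 then r = c (Suc 0) else d (N - 1) = c (Suc N)"
    using Suc.IH[of "\<lambda>l. c (Suc l)"] by blast
  define d' where "d' = case_nat r d"
  have "(\<Sum>l<Suc (Suc N). c l \<star> \<sigma> ^ l) = (\<Sum>l<Suc N. d' l \<star> \<sigma> ^ l) \<star> (\<sigma> - \<sigma>0) + (c 0 + r \<star> \<sigma>0)"
    if \<sigma>: "\<sigma> \<in> ring_center" for \<sigma>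
  proof -
    have comm: "(\<sigma> - \<sigma>0) * \<sigma> = \<sigma> * (\<sigma> - \<sigma>0)" using ring_centerD[OF \<sigma>, of "\<sigma> - \<sigma>0"] by simp
    have shift: "v \<star> \<sigma> ^ Suc l = v \<star> \<sigma> ^ l \<star> \<sigma>" for v :: "'a ^'n" and l
      by (simp add: power_commutes)
    have "(\<Sum>l<Suc (Suc N). c l \<star> \<sigma> ^ l) = c 0 + (\<Sum>l<Suc N. c (Suc l) \<star> \<sigma> ^ l) \<star> \<sigma>"
      unfolding sum.lessThan_Suc_shift[of _ "Suc N"] shift rscale_sum by simp
    also have "\<dots> = c 0 + (\<Sum>l<N. d l \<star> \<sigma> ^ l) \<star> \<sigma> \<star> (\<sigma> - \<sigma>0) + r \<star> \<sigma>"
      unfolding dr(1)[OF \<sigma>] by (simp add: rscale_distrib(1) comm)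
    also have "(\<Sum>l<N. d l \<star> \<sigma> ^ l) \<star> \<sigma> = (\<Sum>l<Suc N. d' l \<star> \<sigma> ^ l) - r"
      unfolding sum.lessThan_Suc_shift[of _ N] shift rscale_sum by (simp add: d'_def)
    finally show ?thesis by (simp add: rscale_distrib)
  qed
  moreover have "d' N = c (Suc N)" using dr(2) by (cases N) (auto simp: d'_def)
  ultimately show ?case by (intro exI[of _ d'] exI[of _ "c 0 + r \<star> \<sigma>0"]) simp
qed

lemma central_polynomial_eq_0:
  fixes c :: "nat \<Rightarrow> 'a::division_ring ^'n"
  assumes "infinite S" "S \<subseteq> ring_center" "\<And>\<sigma>. \<sigma> \<in> S \<Longrightarrow> (\<Sum>l<N. c l \<star> \<sigma> ^ l) = 0" "l < N"
  shows "c l = 0"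
  using assms
proof (induction N arbitrary: S c l)
  case (Suc N)
  obtain \<sigma>0 where \<sigma>0: "\<sigma>0 \<in> S" using Suc.prems(1) by fastforce
  obtain d r where dr: "\<And>\<sigma>. \<sigma> \<in> ring_center \<Longrightarrow>
      (\<Sum>l<Suc N. c l \<star> \<sigma> ^ l) = (\<Sum>l<N. d l \<star> \<sigma> ^ l) \<star> (\<sigma> - \<sigma>0) + r"
    "if N = 0 then r = c 0 else d (N - 1) = c N"
    using central_synthetic_division[where c = c and N = N and ?\<sigma>0.0 = \<sigma>0] by blast
  have "\<sigma>0 \<in> ring_center" using \<sigma>0 Suc.prems(2) by blast
  then have "(\<Sum>l<N. d l \<star> \<sigma>0 ^ l) \<star> (\<sigma>0 - \<sigma>0) + r = 0"
    using dr(1)[of \<sigma>0] Suc.prems(3)[OF \<sigma>0] by (simp only:)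
  then have r: "r = 0" by simp
  have d: "(\<Sum>l<N. d l \<star> \<sigma> ^ l) = 0" if "\<sigma> \<in> S - {\<sigma>0}" for \<sigma>
  proof -
    have \<sigma>: "\<sigma> \<in> S" "\<sigma> \<in> ring_center" "\<sigma> - \<sigma>0 \<noteq> 0" using that Suc.prems(2) by auto
    have "(\<Sum>l<N. d l \<star> \<sigma> ^ l) \<star> (\<sigma> - \<sigma>0) = 0"
      using dr(1)[OF \<sigma>(2)] Suc.prems(3)[OF \<sigma>(1)] r by (simp only: add_0_right)
    then show ?thesis using \<sigma>(3) unfolding rscale_eq_0_iff by (simp only: simp_thms)
  qed
  have "d l = 0" if "l < N" for l
  proof (rule Suc.IH[of "S - {\<sigma>0}" d l])
    show "infinite (S - {\<sigma>0})" "S - {\<sigma>0} \<subseteq> ring_center" using Suc.prems(1,2) by auto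
    show "(\<Sum>l<N. d l \<star> \<sigma> ^ l) = 0" if "\<sigma> \<in> S - {\<sigma>0}" for \<sigma> by (rule d[OF that])
  qed (rule that)
  then have top: "c N = 0" using dr(2) r by (cases "N = 0") simp_all
  then have c: "(\<Sum>l<N. c l \<star> \<sigma> ^ l) = 0" if "\<sigma> \<in> S" for \<sigma> using Suc.prems(3)[OF that] by simp
  have "c l = 0" if "l < N" for l
    by (rule Suc.IH[of S c l, OF Suc.prems(1,2) _ that]) (rule c)
  then show ?case using top Suc.prems(4) by (cases "l = N") simp_all
next
  case 0
  from 0(4) show ?case by (simp only: not_less0)
qed

text \<open>The quantifier over \<open>M\<close> lets two such functions be compared without padding coefficients.\<close>

definition poly_map :: "'a set \<Rightarrow> ('a::division_ring \<Rightarrow> 'a ^'n) \<Rightarrow> bool" where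
  "poly_map S g \<longleftrightarrow> (\<exists>N c. \<forall>M\<ge>N. \<forall>\<sigma>\<in>S. g \<sigma> = (\<Sum>l<M. c l \<star> \<sigma> ^ l))"

lemma poly_map_const: "poly_map S (\<lambda>_. v)"
  unfolding poly_map_def
proof (intro exI[of _ 1] exI[of _ "case_nat v (\<lambda>_. 0)"] allI impI ballI)
  fix M :: nat and \<sigma> :: 'a assume "1 \<le> M"
  then obtain M' where "M = Suc M'" by (cases M) auto
  then show "v = (\<Sum>l<M. case_nat v (\<lambda>_. 0) l \<star> \<sigma> ^ l)"
    by (simp add: sum.lessThan_Suc_shift del: sum.lessThan_Suc)
qed

lemma poly_map_operator:
  assumes "poly_map S g" "\<And>x x'. h (x + x') = h x + h x'"
    "\<And>x \<sigma>. \<sigma> \<in> S \<Longrightarrow> h (x \<star> \<sigma>) = h x \<star> \<sigma>"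
  shows "poly_map S (\<lambda>\<sigma>. h (g \<sigma>))"
proof -
  obtain N c where c: "\<And>M \<sigma>. M \<ge> N \<Longrightarrow> \<sigma> \<in> S \<Longrightarrow> g \<sigma> = (\<Sum>l<M. c l \<star> \<sigma> ^ l)"
    using assms(1) unfolding poly_map_def by blast
  have h0: "h 0 = 0" using assms(2)[of 0 0] by simp
  have hs: "h (\<Sum>l<M. v l) = (\<Sum>l<M. h (v l))" for M :: nat and v
    by (induction M) (simp_all add: h0 assms(2))
  have hp: "h (x \<star> \<sigma> ^ l) = h x \<star> \<sigma> ^ l" if "\<sigma> \<in> S" for x \<sigma> l
  proof (induction l arbitrary: x)
    case (Suc l)
    have "h (x \<star> \<sigma> ^ Suc l) = h (x \<star> \<sigma> \<star> \<sigma> ^ l)" by simp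
    then show ?case using Suc[of "x \<star> \<sigma>"] assms(3)[OF that, of x] by simp
  qed simp
  show ?thesis unfolding poly_map_def
    by (intro exI[of _ N] exI[of _ "\<lambda>l. h (c l)"]) (simp add: c hs hp)
qed

lemma poly_map_add:
  assumes "poly_map S f" "poly_map S g"
  shows "poly_map S (\<lambda>\<sigma>. f \<sigma> + g \<sigma>)"
proof -
  obtain N c where c: "\<And>M \<sigma>. M \<ge> N \<Longrightarrow> \<sigma> \<in> S \<Longrightarrow> f \<sigma> = (\<Sum>l<M. c l \<star> \<sigma> ^ l)"
    using assms(1) unfolding poly_map_def by blast
  obtain N' c' where c': "\<And>M \<sigma>. M \<ge> N' \<Longrightarrow> \<sigma> \<in> S \<Longrightarrow> g \<sigma> = (\<Sum>l<M. c' l \<star> \<sigma> ^ l)"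
    using assms(2) unfolding poly_map_def by blast
  show ?thesis unfolding poly_map_def
  proof (intro exI[of _ "max N N'"] exI[of _ "\<lambda>l. c l + c' l"] allI impI ballI)
    fix M \<sigma> assume M: "max N N' \<le> M" and \<sigma>: "\<sigma> \<in> S"
    show "f \<sigma> + g \<sigma> = (\<Sum>l<M. (c l + c' l) \<star> \<sigma> ^ l)"
      using c[of M \<sigma>] c'[of M \<sigma>] M \<sigma> by (simp add: rscale_distrib sum.distrib)
  qed
qed

lemma poly_map_mult:
  assumes "poly_map S g"
  shows "poly_map S (\<lambda>\<sigma>. g \<sigma> \<star> \<sigma>)"
proof -
  obtain N c where c: "\<And>M \<sigma>. M \<ge> N \<Longrightarrow> \<sigma> \<in> S \<Longrightarrow> g \<sigma> = (\<Sum>l<M. c l \<star> \<sigma> ^ l)"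
    using assms(1) unfolding poly_map_def by blast
  show ?thesis unfolding poly_map_def
  proof (intro exI[of _ "Suc N"] exI[of _ "case_nat 0 c"] allI impI ballI)
    fix M \<sigma> assume M: "Suc N \<le> M" and \<sigma>: "\<sigma> \<in> S"
    then obtain M' where M': "M = Suc M'" "N \<le> M'" by (cases M) auto
    have "g \<sigma> \<star> \<sigma> = (\<Sum>l<M'. c l \<star> \<sigma> ^ Suc l)"
      unfolding c[OF M'(2) \<sigma>] rscale_sum by (simp add: power_commutes)
    then show "g \<sigma> \<star> \<sigma> = (\<Sum>l<M. case_nat 0 c l \<star> \<sigma> ^ l)"
      unfolding M'(1) sum.lessThan_Suc_shift by simp
  qed
qed

lemma poly_map_diff:
  assumes "poly_map S f" "poly_map S g"
  shows "poly_map S (\<lambda>\<sigma>. f \<sigma> - g \<sigma>)"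
  using poly_map_add[OF assms(1) poly_map_operator[OF assms(2), of uminus]] by simp

lemma poly_map_expansion:
  fixes u :: "nat \<Rightarrow> 'a::division_ring ^'n \<Rightarrow> 'a ^'n"
  assumes add: "\<And>i x x'. u i (x + x') = u i x + u i x'"
    and comm: "\<And>i x \<sigma>. \<sigma> \<in> S \<Longrightarrow> u i (x \<star> \<sigma>) = u i x \<star> \<sigma>"
  shows "poly_map S (\<lambda>\<sigma>. expansion ws l (\<lambda>i x. u i x + (R i *v x) \<star> \<sigma>) z k)"
proof (induction ws arbitrary: k)
  case Nil
  show ?case by (simp add: poly_map_const)
next
  case (Cons w ws)
  obtain A i \<alpha> where w: "w = (A, i, \<alpha>)" by (cases w) auto
  let ?y = "\<lambda>\<sigma> i x. u i x + (R i *v x) \<star> \<sigma>"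
  let ?b = "\<lambda>\<sigma>. expansion ws l (?y \<sigma>) z"
  have y: "poly_map S (\<lambda>\<sigma>. ?y \<sigma> i (g \<sigma>))" if "poly_map S g" for g
    by (intro poly_map_add poly_map_mult poly_map_operator[OF that])
      (simp_all add: add comm mult_vec_add mult_rscale)
  have "poly_map S (\<lambda>\<sigma>. linear_factor (?y \<sigma> i) (?b \<sigma>) k)"
    by (cases k) (simp_all add: Cons poly_map_add y)
  moreover have "poly_map S (\<lambda>\<sigma>. geometric (?y \<sigma> i) (?b \<sigma>) k)"
  proof (induction k)
    case (Suc k)
    show ?case using poly_map_diff[OF Cons y[OF Suc]] by simp
  qed (simp add: Cons)
  ultimately have "poly_map S (\<lambda>\<sigma>. (if \<alpha> = 1 then linear_factor else geometric) (?y \<sigma> i) (?b \<sigma>) k)"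
    by auto
  from poly_map_operator[OF this, of "(*v) A"] show ?case
    by (simp add: w mult_vec_add mult_rscale)
qed

text \<open>One polynomial in \<sigma> describes the coefficient both at central \<sigma> and at
  \<open>b\<close>, since the operators commute with right multiplication by either. It has
  infinitely many central roots, so it is zero, also at \<open>b\<close>.\<close>

lemma expansion_eq_0_extend:
  fixes u :: "nat \<Rightarrow> 'a::division_ring ^'n \<Rightarrow> 'a ^'n"
  assumes inf: "infinite (ring_center :: 'a set)"
    and add: "\<And>i x x'. u i (x + x') = u i x + u i x'"
    and comm: "\<And>i x \<sigma>. \<sigma> \<in> insert b ring_center \<Longrightarrow> u i (x \<star> \<sigma>) = u i x \<star> \<sigma>"
    and zero: "\<And>\<sigma>. \<sigma> \<in> ring_center \<Longrightarrow> expansion ws l (\<lambda>i x. u i x + (R i *v x) \<star> \<sigma>) z k = 0"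
  shows "expansion ws l (\<lambda>i x. u i x + (R i *v x) \<star> b) z k = 0"
proof -
  have "poly_map (insert b ring_center) (\<lambda>\<sigma>. expansion ws l (\<lambda>i x. u i x + (R i *v x) \<star> \<sigma>) z k)"
    by (rule poly_map_expansion) (rule add, rule comm)
  then obtain N c where c: "\<And>M \<sigma>. M \<ge> N \<Longrightarrow> \<sigma> \<in> insert b ring_center \<Longrightarrow>
      expansion ws l (\<lambda>i x. u i x + (R i *v x) \<star> \<sigma>) z k = (\<Sum>l<M. c l \<star> \<sigma> ^ l)"
    unfolding poly_map_def by blast
  have "(\<Sum>l<N. c l \<star> \<sigma> ^ l) = 0" if "\<sigma> \<in> ring_center" for \<sigma>
    using zero[OF that] c[of N \<sigma>] that by simp
  then have "c l = 0" if "l < N" for l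
    using that central_polynomial_eq_0[of ring_center c N l] inf by blast
  then show ?thesis using c[of N b] by simp
qed

text \<open>The left multiplications by matrices and the right multiplication by \<open>a\<close> generate an algebra
  whose commutant consists of the right multiplications by the centralizer of \<open>a\<close>.\<close>

definition operators :: "'a::division_ring \<Rightarrow> nat \<Rightarrow> ('a ^'n \<Rightarrow> 'a ^'n) set" where
  "operators a m = {y. \<exists>R. y = (\<lambda>x. \<Sum>j<m. (R j *v x) \<star> a ^ j)}"

text \<open>The powers of \<open>a\<close> are introduced one at a time. With a central \<sigma> in
  place of \<open>a ^ m\<close> the new term is again a matrix and is absorbed into
  \<open>Y\<close>, where the induction hypothesis applies; then
  \<open>expansion_eq_0_extend\<close> replaces \<sigma> by \<open>a ^ m\<close>.\<close>

lemma expansion_eq_0_operators: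
  fixes a :: "'a::division_ring" and z :: "'a ^'n"
  assumes inf: "infinite (ring_center :: 'a set)"
    and zero: "\<And>Y. (\<And>i. i \<notin> J \<Longrightarrow> Y i = 0) \<Longrightarrow> expansion ws l (\<lambda>i x. Y i *v x) z k = 0"
    and y: "\<And>i. i \<in> J \<Longrightarrow> y i \<in> operators a m" "\<And>i x. i \<notin> J \<Longrightarrow> y i x = 0"
  shows "expansion ws l y z k = 0"
proof -
  have *: "expansion ws l (\<lambda>i x. Y i *v x + (\<Sum>j<m. (R i j *v x) \<star> a ^ j)) z k = 0"
    if "\<And>i. i \<notin> J \<Longrightarrow> Y i = 0" "\<And>i j. i \<notin> J \<Longrightarrow> R i j = 0" for Y R m
    using that
  proof (induction m arbitrary: Y)
    case 0
    then show ?case using zero by simp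
  next
    case (Suc m)
    let ?u = "\<lambda>i x. Y i *v x + (\<Sum>j<m. (R i j *v x) \<star> a ^ j)"
    have "expansion ws l (\<lambda>i x. ?u i x + (R i m *v x) \<star> a ^ m) z k = 0"
    proof (rule expansion_eq_0_extend[OF inf])
      show "?u i (x + x') = ?u i x + ?u i x'" for i x x'
        by (simp add: mult_vec_add rscale_distrib sum.distrib)
      show "?u i (x \<star> \<sigma>) = ?u i x \<star> \<sigma>" if \<sigma>: "\<sigma> \<in> insert (a ^ m) ring_center" for i x \<sigma>
      proof -
        have "\<sigma> * a ^ j = a ^ j * \<sigma>" for j
        proof (cases "\<sigma> = a ^ m")
          case True
          then show ?thesis by (simp add: power_add[symmetric] add.commute)
        qed (use \<sigma> ring_centerD in blast)
        then show ?thesis by (simp add: mult_rscale rscale_distrib rscale_sum)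
      qed
      show "expansion ws l (\<lambda>i x. ?u i x + (R i m *v x) \<star> \<sigma>) z k = 0" if \<sigma>: "\<sigma> \<in> ring_center" for \<sigma>
      proof -
        have eq: "(\<lambda>i x. ?u i x + (R i m *v x) \<star> \<sigma>) =
            (\<lambda>i x. (Y i + mscale (R i m) \<sigma>) *v x + (\<Sum>j<m. (R i j *v x) \<star> a ^ j))"
          by (simp add: fun_eq_iff add_mult_vec mscale_mult_vec[OF \<sigma>])
        have "expansion ws l (\<lambda>i x. (Y i + mscale (R i m) \<sigma>) *v x + (\<Sum>j<m. (R i j *v x) \<star> a ^ j)) z k = 0"
          by (rule Suc.IH) (use Suc.prems in \<open>auto simp: mscale_def vec_eq_iff\<close>)
        then show ?thesis unfolding eq .
      qed
    qed
    then show ?case by (simp add: add.assoc)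
  qed
  have "\<exists>R. \<forall>i. (i \<in> J \<longrightarrow> y i = (\<lambda>x. \<Sum>j<m. (R i j *v x) \<star> a ^ j)) \<and> (i \<notin> J \<longrightarrow> R i = (\<lambda>_. 0))"
  proof (rule choice, rule allI)
    show "\<exists>R. (i \<in> J \<longrightarrow> y i = (\<lambda>x. \<Sum>j<m. (R j *v x) \<star> a ^ j)) \<and> (i \<notin> J \<longrightarrow> R = (\<lambda>_. 0))" for i
      using y(1)[of i] by (cases "i \<in> J") (auto simp: operators_def)
  qed
  then obtain R where R: "\<And>i. i \<in> J \<Longrightarrow> y i = (\<lambda>x. \<Sum>j<m. (R i j *v x) \<star> a ^ j)"
    "\<And>i. i \<notin> J \<Longrightarrow> R i = (\<lambda>_. 0)" by blast
  have "y i = (\<lambda>x. 0 *v x + (\<Sum>j<m. (R i j *v x) \<star> a ^ j))" for i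
    by (cases "i \<in> J") (auto simp: R y(2))
  then have "y = (\<lambda>i x. 0 *v x + (\<Sum>j<m. (R i j *v x) \<star> a ^ j))" by blast
  then show ?thesis using *[of "\<lambda>_. 0" R m] R(2) by simp
qed

section \<open>Density\<close>

definition centralizer :: "'a::division_ring \<Rightarrow> 'a set" where
  "centralizer a = {c. c * a = a * c}"

lemma centralizer_closed:
  "0 \<in> centralizer a" "1 \<in> centralizer a" "a \<in> centralizer a"
  "c \<in> centralizer a \<Longrightarrow> - c \<in> centralizer a"
  "c \<in> centralizer a \<Longrightarrow> inverse c \<in> centralizer a"
  "c \<in> centralizer a \<Longrightarrow> d \<in> centralizer a \<Longrightarrow> c + d \<in> centralizer a"
  "c \<in> centralizer a \<Longrightarrow> d \<in> centralizer a \<Longrightarrow> c - d \<in> centralizer a"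
  "c \<in> ring_center \<Longrightarrow> c \<in> centralizer a"
  by (simp_all add: centralizer_def distrib_left distrib_right left_diff_distrib right_diff_distrib
      inverse_commute ring_centerD)

lemma centralizer_mult:
  assumes "c \<in> centralizer a" "d \<in> centralizer a"
  shows "c * d \<in> centralizer a"
proof -
  have "c * d * a = c * (a * d)" using assms(2) by (simp add: centralizer_def mult.assoc)
  also have "\<dots> = a * (c * d)" using assms(1) by (simp add: centralizer_def mult.assoc[symmetric])
  finally show ?thesis by (simp add: centralizer_def)
qed

inductive_set rspan :: "'a::division_ring \<Rightarrow> ('a ^'n) set \<Rightarrow> ('a ^'n) set" for a S where
  rspan_zero: "0 \<in> rspan a S"
| rspan_step: "x \<in> rspan a S \<Longrightarrow> s \<in> S \<Longrightarrow> c \<in> centralizer a \<Longrightarrow> x + s \<star> c \<in> rspan a S"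

lemma rspan_base: "s \<in> S \<Longrightarrow> s \<in> rspan a S"
  using rspan_step[OF rspan_zero, of s S 1 a] by (simp add: centralizer_closed)

lemma rspan_scale: "x \<in> rspan a S \<Longrightarrow> c \<in> centralizer a \<Longrightarrow> x \<star> c \<in> rspan a S"
  by (induction rule: rspan.induct) (auto simp: rspan_step rspan_zero rscale_distrib(1) centralizer_mult)

lemma rspan_mono: "x \<in> rspan a S \<Longrightarrow> S \<subseteq> S' \<Longrightarrow> x \<in> rspan a S'"
  by (induction rule: rspan.induct) (auto intro: rspan_step rspan_zero)

lemma rspan_insert_iff:
  "v \<in> rspan a (insert x S) \<longleftrightarrow> (\<exists>c\<in>centralizer a. v - x \<star> c \<in> rspan a S)"
proof
  assume "v \<in> rspan a (insert x S)"
  then show "\<exists>c\<in>centralizer a. v - x \<star> c \<in> rspan a S"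
  proof induction
    case rspan_zero
    show ?case by (rule bexI[of _ 0]) (simp_all add: centralizer_closed rspan.rspan_zero)
  next
    case (rspan_step y s d)
    then obtain c where c: "c \<in> centralizer a" "y - x \<star> c \<in> rspan a S" by blast
    show ?case
    proof (cases "s = x")
      case True
      have "y + s \<star> d - x \<star> (c + d) = y - x \<star> c" using True by (simp add: rscale_distrib)
      then show ?thesis using c rspan_step centralizer_closed(6) by metis
    next
      case False
      have "y + s \<star> d - x \<star> c = (y - x \<star> c) + s \<star> d" by simp
      then show ?thesis using c False rspan_step rspan.rspan_step by (metis insertE)
    qed
  qed
next
  assume "\<exists>c\<in>centralizer a. v - x \<star> c \<in> rspan a S"
  then obtain c where c: "c \<in> centralizer a" "v - x \<star> c \<in> rspan a S" by blast
  then have "v - x \<star> c + x \<star> c \<in> rspan a (insert x S)"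
    by (intro rspan_step rspan_mono[OF c(2)]) auto
  then show "v \<in> rspan a (insert x S)" by simp
qed

lemma operators_linear:
  assumes "y \<in> operators a m"
  shows "y (x + x') = y x + y x'" "y (x - x') = y x - y x'" "y 0 = 0"
    "c \<in> centralizer a \<Longrightarrow> y (x \<star> c) = y x \<star> c"
proof -
  obtain R where R: "y = (\<lambda>x. \<Sum>j<m. (R j *v x) \<star> a ^ j)" using assms by (auto simp: operators_def)
  show "y (x + x') = y x + y x'" "y (x - x') = y x - y x'" "y 0 = 0"
    by (simp_all add: R mult_vec_add mult_vec_diff rscale_distrib sum.distrib sum_subtractf)
  assume "c \<in> centralizer a"
  then have "a ^ j * c = c * a ^ j" for j
    by (induction j) (simp_all add: centralizer_def mult.assoc, simp add: mult.assoc[symmetric])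
  then show "y (x \<star> c) = y x \<star> c" by (simp add: R mult_rscale rscale_sum)
qed

lemma operators_rspan_eq_0:
  assumes "y \<in> operators a m" "\<forall>s\<in>S. y s = 0" "x \<in> rspan a S"
  shows "y x = 0"
  using assms(3) by induction (use assms(2) in \<open>auto simp: operators_linear[OF assms(1)]\<close>)

lemma operators_mono:
  assumes "m \<le> m'" shows "operators a m \<subseteq> operators a m'"
proof
  fix y assume "y \<in> operators a m"
  then obtain R where R: "y = (\<lambda>x. \<Sum>j<m. (R j *v x) \<star> a ^ j)" by (auto simp: operators_def)
  have "(\<Sum>j<m. (R j *v x) \<star> a ^ j) = (\<Sum>j<m'. ((if j < m then R j else 0) *v x) \<star> a ^ j)" for x
    by (rule sum.mono_neutral_cong_left) (use assms in auto)
  then show "y \<in> operators a m'"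
    unfolding operators_def R by (intro CollectI exI[of _ "\<lambda>j. if j < m then R j else 0"] ext)
qed

lemma operators_add:
  assumes "y \<in> operators a m" "y' \<in> operators a m"
  shows "(\<lambda>x. y x + y' x) \<in> operators a m"
proof -
  obtain R where R: "y = (\<lambda>x. \<Sum>j<m. (R j *v x) \<star> a ^ j)" using assms(1) by (auto simp: operators_def)
  obtain R' where R': "y' = (\<lambda>x. \<Sum>j<m. (R' j *v x) \<star> a ^ j)" using assms(2) by (auto simp: operators_def)
  show ?thesis unfolding operators_def
    by (intro CollectI exI[of _ "\<lambda>j. R j + R' j"] ext)
      (simp add: R R' add_mult_vec rscale_distrib sum.distrib)
qed

lemma operators_mult:
  assumes "y \<in> operators a m"
  shows "(\<lambda>x. B *v y x) \<in> operators a m"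
proof -
  obtain R where R: "y = (\<lambda>x. \<Sum>j<m. (R j *v x) \<star> a ^ j)" using assms(1) by (auto simp: operators_def)
  show ?thesis unfolding operators_def
    by (intro CollectI exI[of _ "\<lambda>j. B ** R j"] ext)
      (simp add: R mult_vec_sum mult_rscale matrix_vector_mul_assoc)
qed

lemma operators_shift:
  assumes "y \<in> operators a m"
  shows "(\<lambda>x. y x \<star> a) \<in> operators a (Suc m)"
proof -
  obtain R where R: "y = (\<lambda>x. \<Sum>j<m. (R j *v x) \<star> a ^ j)" using assms(1) by (auto simp: operators_def)
  have "y x \<star> a = (\<Sum>j<Suc m. (case_nat 0 R j *v x) \<star> a ^ j)" for x
    unfolding sum.lessThan_Suc_shift by (simp add: R rscale_sum power_commutes)
  then show ?thesis unfolding operators_def by (intro CollectI exI[of _ "case_nat 0 R"] ext)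
qed

lemma operators_central:
  assumes "y \<in> operators a m" "\<sigma> \<in> ring_center"
  shows "(\<lambda>x. y x \<star> \<sigma>) \<in> operators a m"
proof -
  obtain R where R: "y = (\<lambda>x. \<Sum>j<m. (R j *v x) \<star> a ^ j)" using assms(1) by (auto simp: operators_def)
  have "y x \<star> \<sigma> = (\<Sum>j<m. (mscale (R j) \<sigma> *v x) \<star> a ^ j)" for x
    using ring_centerD[OF assms(2)] by (simp add: R rscale_sum mscale_mult_vec[OF assms(2)])
  then show ?thesis unfolding operators_def by (intro CollectI exI[of _ "\<lambda>j. mscale (R j) \<sigma>"] ext)
qed

lemma operators_matrix: "(\<lambda>x. B *v x) \<in> operators a 1"
  unfolding operators_def by (intro CollectI exI[of _ "\<lambda>_. B"] ext) simp

lemma matrix_transitive: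
  fixes v t :: "'a::division_ring ^'n"
  assumes "v \<noteq> 0"
  obtains B where "B *v v = t"
proof -
  obtain i where i: "v $ i \<noteq> 0" using assms by (auto simp: vec_eq_iff)
  have "(\<chi> k j. if j = i then t $ k * inverse (v $ i) else 0) *v v = t"
    using i by (simp add: vec_eq_iff matrix_vector_mult_def if_distrib if_distribR mult.assoc
        sum.delta cong: if_cong)
  then show thesis using that by blast
qed

lemma commutant:
  fixes \<theta> :: "'a::division_ring ^'n \<Rightarrow> 'a ^'n"
  assumes \<theta>: "\<And>B t. \<theta> (B *v t) = B *v \<theta> t" "\<And>t. \<theta> (t \<star> a) = \<theta> t \<star> a"
  obtains c where "c \<in> centralizer a" "\<And>t. \<theta> t = t \<star> c"
proof -
  fix i0 :: 'n
  define e :: "'a ^'n" where "e = axis i0 1"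
  \<comment> \<open>\<open>M t\<close> sends the basis vector \<open>e\<close> to \<open>t\<close>,
    so the value of \<theta> at \<open>e\<close> determines \<theta> everywhere, without any
    additivity assumption.\<close>
  define M where "M t = (\<chi> i j. if j = i0 then t $ i else 0)" for t :: "'a ^'n"
  have M: "M t *v x = t \<star> (x $ i0)" for t x
    by (simp add: vec_eq_iff M_def matrix_vector_mult_def if_distrib if_distribR sum.delta cong: if_cong)
  define c where "c = \<theta> e $ i0"
  have t: "\<theta> t = t \<star> c" for t
    using \<theta>(1)[of "M t" e] by (simp add: M c_def) (simp add: e_def)
  have "e \<star> (a * c) = e \<star> (c * a)"
    using \<theta>(2)[of e] unfolding t by simp
  then have "(e \<star> (a * c)) $ i0 = (e \<star> (c * a)) $ i0" by simp
  then have "c \<in> centralizer a" by (simp add: e_def centralizer_def)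
  then show thesis using t that by blast
qed

text \<open>Jacobson's argument. Suppose that every operator killing \<open>S\<close> and
  \<open>x\<close> also kills \<open>u\<close>. Then \<open>y x\<close> determines
  \<open>y u\<close> for all \<open>y\<close> killing \<open>S\<close>, and this correspondence
  commutes with the algebra, so it is right multiplication by some \<open>c\<close> in the
  centralizer. All these \<open>y\<close> kill \<open>u - x \<star> c\<close>, which by induction
  lies in the span of \<open>S\<close>.\<close>

lemma density:
  fixes S :: "('a::division_ring ^'n) set"
  assumes "finite S" "u \<notin> rspan a S"
  shows "\<exists>m. \<exists>y\<in>operators a m. (\<forall>s\<in>S. y s = 0) \<and> y u = t"
  using assms
proof (induction S arbitrary: u t rule: finite_induct)
  case empty
  then have "u \<noteq> 0" using rspan_zero by blast
  then obtain B where "B *v u = t" by (rule matrix_transitive)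
  then show ?case using operators_matrix by blast
next
  case (insert x S)
  have uS: "u \<notin> rspan a S" using insert.prems rspan_mono by blast
  show ?case
  proof (cases "x \<in> rspan a S")
    case True
    obtain m y where y: "y \<in> operators a m" "\<forall>s\<in>S. y s = 0" "y u = t" using insert.IH[OF uS] by blast
    have "y x = 0" by (rule operators_rspan_eq_0[OF y(1,2) True])
    then show ?thesis using y by blast
  next
    case False
    have "\<exists>m. \<exists>y\<in>operators a m. (\<forall>s\<in>insert x S. y s = 0) \<and> y u \<noteq> 0"
    proof (rule ccontr)
      assume "\<not> ?thesis"
      then have contra: "y u = 0" if "y \<in> operators a m" "\<forall>s\<in>insert x S. y s = 0" for y m
        using that by blast
      \<comment> \<open>Well-definedness of the map sending \<open>y x\<close> to
        \<open>y u\<close>.\<close>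
      have unique: "y u = y' u"
        if "y \<in> operators a m" "\<forall>s\<in>S. y s = 0" "y' \<in> operators a m'" "\<forall>s\<in>S. y' s = 0" "y x = y' x" for y y' m m'
      proof -
        have y: "y \<in> operators a (max m m')" "y' \<in> operators a (max m m')"
          using that(1,3) operators_mono[of m "max m m'" a] operators_mono[of m' "max m m'" a] by auto
        have "(- mat 1 + mat 1) *v v = 0" for v :: "'a ^'n" by simp
        then have "(- mat 1) *v v = - v" for v :: "'a ^'n"
          unfolding add_mult_vec by (simp add: eq_neg_iff_add_eq_0)
        then have "(\<lambda>x. y x - y' x) \<in> operators a (max m m')"
          using operators_add[OF y(1) operators_mult[OF y(2), of "- mat 1"]] by simp
        moreover have "\<forall>s\<in>insert x S. y s - y' s = 0" using that(2,4,5) by simp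
        ultimately have "y u - y' u = 0" by (rule contra)
        then show ?thesis by simp
      qed
      have "\<forall>t. \<exists>y. (\<exists>m. y \<in> operators a m) \<and> (\<forall>s\<in>S. y s = 0) \<and> y x = t"
        using insert.IH[OF False] by blast
      then obtain Y where Y: "\<And>t. \<exists>m. Y t \<in> operators a m" "\<And>t. \<forall>s\<in>S. Y t s = 0" "\<And>t. Y t x = t"
        by metis
      define \<theta> where "\<theta> t = Y t u" for t
      have \<theta>: "y u = \<theta> (y x)" if "y \<in> operators a m" "\<forall>s\<in>S. y s = 0" for y m
        using unique[OF that] Y unfolding \<theta>_def by metis
      have \<theta>B: "\<theta> (B *v t) = B *v \<theta> t" for B t
      proof -
        obtain m where "Y t \<in> operators a m" using Y(1) by blast
        from \<theta>[OF operators_mult[OF this, of B]] show ?thesis using Y(2,3) by (simp add: \<theta>_def)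
      qed
      have \<theta>a: "\<theta> (t \<star> a) = \<theta> t \<star> a" for t
      proof -
        obtain m where "Y t \<in> operators a m" using Y(1) by blast
        from \<theta>[OF operators_shift[OF this]] show ?thesis using Y(2,3) by (simp add: \<theta>_def)
      qed
      obtain c where c: "c \<in> centralizer a" "\<And>t. \<theta> t = t \<star> c" using commutant[OF \<theta>B \<theta>a] by blast
      have zero: "y (u - x \<star> c) = 0" if y: "y \<in> operators a m" "\<forall>s\<in>S. y s = 0" for y m
        using \<theta>[OF y] c by (simp add: operators_linear[OF y(1)])
      have "u - x \<star> c \<in> rspan a S"
      proof (rule ccontr)
        assume "u - x \<star> c \<notin> rspan a S"
        then obtain m y where "y \<in> operators a m" "\<forall>s\<in>S. y s = 0" "y (u - x \<star> c) = axis undefined 1"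
          using insert.IH by blast
        then show False using zero by fastforce
      qed
      then show False using insert.prems c(1) rspan_insert_iff by blast
    qed
    then obtain m y where y: "y \<in> operators a m" "\<forall>s\<in>insert x S. y s = 0" "y u \<noteq> 0" by blast
    obtain B where "B *v y u = t" using y(3) by (rule matrix_transitive)
    then show ?thesis using operators_mult[OF y(1), of B] y(2)
      by (intro exI[of _ m] bexI[of _ "\<lambda>x. B *v y x"]) auto
  qed
qed

text \<open>Density prescribes values only on finitely many vectors, so rank one is demanded only on
  a finite test set. A test vector in the span of \<open>u\<close> and \<open>S\<close> has its
  value forced into the line of \<open>v\<close>; any other one is added to the vectors to be
  killed.\<close>

lemma rank_one_operator:
  assumes "finite X'" "finite S" "u \<notin> rspan a S"
  shows "\<exists>m. \<exists>y\<in>operators a m. (\<forall>s\<in>S. y s = 0) \<and> (\<forall>x\<in>X'. \<exists>c\<in>centralizer a. y x = v \<star> c) \<and> y u = v"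
  using assms
proof (induction X' arbitrary: S rule: finite_induct)
  case empty
  then show ?case using density[OF empty(1,2), of v] by blast
next
  case (insert x X')
  show ?case
  proof (cases "x \<in> rspan a (insert u S)")
    case True
    then obtain c where c: "c \<in> centralizer a" "x - u \<star> c \<in> rspan a S" using rspan_insert_iff by blast
    obtain m y where y: "y \<in> operators a m" "\<forall>s\<in>S. y s = 0"
      "\<forall>x\<in>X'. \<exists>c\<in>centralizer a. y x = v \<star> c" "y u = v"
      using insert.IH[OF insert.prems] by blast
    have "y (x - u \<star> c) = 0" by (rule operators_rspan_eq_0[OF y(1,2) c(2)])
    then have "y x = v \<star> c" using y(4) c(1) by (simp add: operators_linear[OF y(1)])
    then have x: "\<exists>c\<in>centralizer a. y x = v \<star> c" using c(1) by (rule bexI)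
    show ?thesis
    proof (intro exI[of _ m] bexI[of _ y] conjI)
      show "\<forall>x\<in>insert x X'. \<exists>c\<in>centralizer a. y x = v \<star> c" using y(3) x by (simp only: ball_simps simp_thms)
    qed (rule y)+
  next
    case False
    \<comment> \<open>The exchange property: otherwise \<open>x\<close> would lie in the span of
      \<open>u\<close> and \<open>S\<close>.\<close>
    have u: "u \<notin> rspan a (insert x S)"
    proof
      assume "u \<in> rspan a (insert x S)"
      then obtain c where c: "c \<in> centralizer a" "u - x \<star> c \<in> rspan a S" using rspan_insert_iff by blast
      have "c \<noteq> 0" using c(2) insert.prems(2) by auto
      then have "x - u \<star> inverse c = (u - x \<star> c) \<star> (- inverse c)" by (simp add: rscale_distrib)
      also have "\<dots> \<in> rspan a S" by (rule rspan_scale[OF c(2)]) (use c(1) in \<open>simp add: centralizer_closed\<close>)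
      finally show False using False c(1) rspan_insert_iff centralizer_closed(5) by metis
    qed
    have "finite (insert x S)" using insert.prems(1) by simp
    from insert.IH[OF this u] obtain m y where y: "y \<in> operators a m" "\<forall>s\<in>insert x S. y s = 0"
      "\<forall>x\<in>X'. \<exists>c\<in>centralizer a. y x = v \<star> c" "y u = v" by blast
    have "y x = v \<star> 0" using y(2) by simp
    then have x: "\<exists>c\<in>centralizer a. y x = v \<star> c" using centralizer_closed(1) by (rule bexI)
    show ?thesis
    proof (intro exI[of _ m] bexI[of _ y] conjI)
      show "\<forall>s\<in>S. y s = 0" using y(2) by simp
      show "\<forall>x\<in>insert x X'. \<exists>c\<in>centralizer a. y x = v \<star> c" using y(3) x by (simp only: ball_simps simp_thms)
    qed (rule y)+
  qed
qed

section \<open>Generic choices\<close>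

text \<open>On the line \<open>f + g \<star> s\<close>, where \<open>f\<close> meets the old
  conditions and \<open>g\<close> the new one, each condition fails for finitely many
  \<open>s\<close> only. For the new condition the line is viewed from its other end:
  \<open>g + f \<star> inverse s\<close>, rescaled by \<open>s\<close>, is the same point.\<close>

lemma generic_choice:
  fixes P :: "'q \<Rightarrow> ('i \<Rightarrow> 'a::division_ring ^'n) \<Rightarrow> bool"
  assumes inf: "infinite (ring_center :: 'a set)" and Q: "finite Q" and Y: "Y \<noteq> {}"
    and closed: "\<And>f g s. f \<in> Y \<Longrightarrow> g \<in> Y \<Longrightarrow> s \<in> ring_center \<Longrightarrow> (\<lambda>i. f i + g i \<star> s) \<in> Y"
    and ex: "\<And>q. q \<in> Q \<Longrightarrow> \<exists>f\<in>Y. P q f"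
    and gen: "\<And>q f g. q \<in> Q \<Longrightarrow> f \<in> Y \<Longrightarrow> g \<in> Y \<Longrightarrow> P q f \<Longrightarrow>
      finite {s \<in> ring_center. \<not> P q (\<lambda>i. f i + g i \<star> s)}"
    and hom: "\<And>q f s. q \<in> Q \<Longrightarrow> P q f \<Longrightarrow> s \<in> ring_center \<Longrightarrow> s \<noteq> 0 \<Longrightarrow> P q (\<lambda>i. f i \<star> s)"
  shows "\<exists>f\<in>Y. \<forall>q\<in>Q. P q f"
  using Q ex gen hom
proof (induction Q rule: finite_induct)
  case empty
  then show ?case using Y by blast
next
  case (insert q Q)
  have "\<exists>f\<in>Y. \<forall>q\<in>Q. P q f"
  proof (rule insert.IH)
    show "\<exists>f\<in>Y. P q' f" if "q' \<in> Q" for q' by (rule insert.prems(1)[OF insertI2[OF that]])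
    show "finite {s \<in> ring_center. \<not> P q' (\<lambda>i. f i + g i \<star> s)}"
      if "q' \<in> Q" "f \<in> Y" "g \<in> Y" "P q' f" for q' f g
      by (rule insert.prems(2)[OF insertI2[OF that(1)] that(2-4)])
    show "P q' (\<lambda>i. f i \<star> s)" if "q' \<in> Q" "P q' f" "s \<in> ring_center" "s \<noteq> 0" for q' f s
      by (rule insert.prems(3)[OF insertI2[OF that(1)] that(2-4)])
  qed
  then obtain f where f: "f \<in> Y" "\<forall>q\<in>Q. P q f" ..
  from insert.prems(1)[OF insertI1] obtain g where g: "g \<in> Y" "P q g" ..
  define B1 where "B1 = (\<Union>q'\<in>Q. {s \<in> ring_center. \<not> P q' (\<lambda>i. f i + g i \<star> s)})"
  define B2 where "B2 = {s \<in> ring_center. \<not> P q (\<lambda>i. g i + f i \<star> s)}"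
  have "finite B1" unfolding B1_def
  proof (rule finite_UN_I[OF insert.hyps(1)])
    fix q' assume q': "q' \<in> Q"
    show "finite {s \<in> ring_center. \<not> P q' (\<lambda>i. f i + g i \<star> s)}"
      by (rule insert.prems(2)[OF insertI2[OF q'] f(1) g(1)]) (use f(2) q' in blast)
  qed
  moreover have "finite B2" unfolding B2_def
    by (rule insert.prems(2)[OF insertI1 g(1) f(1) g(2)])
  ultimately have "finite (B1 \<union> inverse ` B2 \<union> {0})" by simp
  then have "infinite (ring_center - (B1 \<union> inverse ` B2 \<union> {0}))" using inf by auto
  then obtain s where "s \<in> ring_center - (B1 \<union> inverse ` B2 \<union> {0})" using infinite_imp_nonempty by blast
  then have s: "s \<in> ring_center" "s \<noteq> 0" "s \<notin> B1" "s \<notin> inverse ` B2" by auto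
  have "inverse s \<notin> B2" using s(4) by (metis image_eqI inverse_inverse_eq)
  then have "P q (\<lambda>i. g i + f i \<star> inverse s)" using ring_center_inverse[OF s(1)] unfolding B2_def by blast
  then have "P q (\<lambda>i. (g i + f i \<star> inverse s) \<star> s)" by (rule insert.prems(3)[OF insertI1 _ s(1,2)])
  moreover have "(\<lambda>i. (g i + f i \<star> inverse s) \<star> s) = (\<lambda>i. f i + g i \<star> s)"
    using s(2) by (simp add: rscale_distrib add.commute)
  ultimately have "P q (\<lambda>i. f i + g i \<star> s)" by (simp only:)
  moreover have "P q' (\<lambda>i. f i + g i \<star> s)" if "q' \<in> Q" for q'
    using s(1,3) that unfolding B1_def by blast
  ultimately have "\<forall>q'\<in>insert q Q. P q' (\<lambda>i. f i + g i \<star> s)" by (simp only: ball_simps simp_thms) blast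
  then show ?case using closed[OF f(1) g(1) s(1)] by (rule bexI)
qed

section \<open>Pairs of vectors independent over the centralizer\<close>

definition independent_pair :: "'a::division_ring \<Rightarrow> 'a ^'n \<Rightarrow> 'a ^'n \<Rightarrow> bool" where
  "independent_pair a p q \<longleftrightarrow> q \<noteq> 0 \<and> (\<forall>c\<in>centralizer a. p \<noteq> q \<star> c)"

text \<open>The centralizer may be noncommutative, so no determinant detects dependence. Eliminating
  \<open>p1\<close> from the two relations expresses \<open>q1\<close> through \<open>p0\<close> and
  \<open>q0\<close>; apart from \<alpha>, the parameter \<open>t\<close> survives only in
  \<open>inverse t\<close>.\<close>

lemma independent_pair_line_aux:
  fixes p0 p1 q0 q1 :: "'a::division_ring ^'n"
  assumes ind: "independent_pair a p0 q0"
    and s: "s \<in> ring_center" "s \<noteq> 0" and t: "t \<in> ring_center" "t \<noteq> 0" and st: "s \<noteq> t"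
    and c: "c \<in> centralizer a" "p0 + p1 \<star> s = (q0 + q1 \<star> s) \<star> c"
    and c': "c' \<in> centralizer a" "p0 + p1 \<star> t = (q0 + q1 \<star> t) \<star> c'"
  shows "\<exists>\<alpha>\<in>centralizer a. q1 = p0 \<star> \<alpha> - q0 \<star> (c * \<alpha> + inverse t)"
proof -
  have scale: "p1 = q0 \<star> (c * inverse s) + q1 \<star> c - p0 \<star> inverse s"
    if "s \<in> ring_center" "s \<noteq> 0" "p0 + p1 \<star> s = (q0 + q1 \<star> s) \<star> c" for s c
  proof -
    have "(p0 + p1 \<star> s) \<star> inverse s = (q0 + q1 \<star> s) \<star> c \<star> inverse s" using that(3) by simp
    moreover have "s * c * inverse s = c"
      unfolding ring_centerD[OF that(1)] using that(2) by (simp add: mult.assoc)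
    ultimately have "p0 \<star> inverse s + p1 = q0 \<star> (c * inverse s) + q1 \<star> c"
      using that(2) by (simp add: rscale_distrib)
    then show ?thesis by (simp add: algebra_simps)
  qed
  define u where "u = inverse s - inverse t"
  define d where "d = c - c'"
  have "q0 \<star> (c * inverse s) + q1 \<star> c - p0 \<star> inverse s = q0 \<star> (c' * inverse t) + q1 \<star> c' - p0 \<star> inverse t"
    using scale[OF s c(2)] scale[OF t c'(2)] by simp
  moreover have "q0 \<star> (c * u + d * inverse t) = q0 \<star> (c * inverse s) - q0 \<star> (c' * inverse t)"
    by (simp add: u_def d_def algebra_simps rscale_distrib)
  ultimately have main: "q1 \<star> d = p0 \<star> u - q0 \<star> (c * u + d * inverse t)"
    by (simp add: u_def d_def rscale_distrib algebra_simps)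
  have u: "u \<noteq> 0" "u \<in> centralizer a"
    using st s t unfolding u_def by (simp_all add: centralizer_closed)
  have d: "d \<noteq> 0"
  proof
    assume "d = 0"
    then have "p0 \<star> u = q0 \<star> c \<star> u" using main by simp
    then have "(p0 - q0 \<star> c) \<star> u = 0" by (simp add: rscale_distrib)
    then have "p0 = q0 \<star> c" using u(1) by simp
    then show False using ind c(1) by (auto simp: independent_pair_def)
  qed
  define \<alpha> where "\<alpha> = u * inverse d"
  have "inverse t * inverse d = inverse d * inverse t"
    using ring_centerD[OF ring_center_inverse[OF t(1)]] .
  then have "d * (inverse t * inverse d) = inverse t"
    using d by (simp add: mult.assoc[symmetric])
  then have "(c * u + d * inverse t) * inverse d = c * \<alpha> + inverse t"
    by (simp add: \<alpha>_def distrib_right mult.assoc)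
  moreover have "q1 = (p0 \<star> u - q0 \<star> (c * u + d * inverse t)) \<star> inverse d"
    using d unfolding main[symmetric] by simp
  ultimately have "q1 = p0 \<star> \<alpha> - q0 \<star> (c * \<alpha> + inverse t)"
    by (simp add: rscale_distrib(3) \<alpha>_def)
  moreover have "\<alpha> \<in> centralizer a" unfolding \<alpha>_def d_def
    using u(2) c(1) c'(1) by (simp add: centralizer_mult centralizer_closed)
  ultimately show ?thesis by blast
qed

text \<open>Three bad parameters already contradict independence: \<open>s\<close> is paired with
  \<open>t\<close> and with \<open>t'\<close>, and equating the two resulting expressions for
  \<open>q1\<close> gives a relation between \<open>p0\<close> and \<open>q0\<close>, nontrivial
  because \<open>inverse t\<close> and \<open>inverse t'\<close> differ.\<close>

lemma independent_pair_line:
  fixes p0 p1 q0 q1 :: "'a::division_ring ^'n"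
  assumes ind: "independent_pair a p0 q0"
  shows "finite {s \<in> ring_center. \<not> independent_pair a (p0 + p1 \<star> s) (q0 + q1 \<star> s)}"
proof (rule ccontr)
  let ?B = "{s \<in> ring_center. \<not> independent_pair a (p0 + p1 \<star> s) (q0 + q1 \<star> s)}"
  assume inf: "infinite ?B"
  have q0: "q0 \<noteq> 0" using ind by (simp add: independent_pair_def)
  have unique: "s = s'" if "q0 + q1 \<star> s = 0" "q0 + q1 \<star> s' = 0" for s s'
  proof (rule ccontr)
    assume "s \<noteq> s'"
    have "q1 \<star> (s - s') = (q0 + q1 \<star> s) - (q0 + q1 \<star> s')" by (simp add: rscale_distrib)
    then have "q1 \<star> (s - s') = 0" unfolding that by simp
    then have "q1 = 0" using \<open>s \<noteq> s'\<close> by simp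
    then show False using that(1) q0 by simp
  qed
  \<comment> \<open>The only parameter at which the second vector can vanish. If there is none,
    \<open>s0\<close> is arbitrary, and discarding it is harmless.\<close>
  define s0 where "s0 = (SOME s. q0 + q1 \<star> s = 0)"
  have s0: "s = s0" if "q0 + q1 \<star> s = 0" for s
    by (rule unique[OF that]) (unfold s0_def, rule someI[where P = "\<lambda>s. q0 + q1 \<star> s = 0", OF that])
  have "infinite (?B - {0, s0})" by (rule Diff_infinite_finite[OF _ inf]) simp
  from infinite_arbitrarily_large[OF this, of 3] obtain E where
    E: "E \<subseteq> ?B - {0, s0}" "card E = 3" by blast
  obtain s t t' where stE: "E = {s, t, t'}" and stt: "s \<noteq> t" "s \<noteq> t'" "t \<noteq> t'"
    using E(2)[unfolded card_3_iff] by blast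
  have memB: "s \<in> ?B - {0, s0}" "t \<in> ?B - {0, s0}" "t' \<in> ?B - {0, s0}"
    by (rule subsetD[OF E(1)], simp add: stE)+
  have ex: "\<exists>c\<in>centralizer a. p0 + p1 \<star> s = (q0 + q1 \<star> s) \<star> c" if "s \<in> ?B - {0, s0}" for s
  proof -
    have "q0 + q1 \<star> s \<noteq> 0" using that s0 by blast
    then show ?thesis using that unfolding independent_pair_def by blast
  qed
  from ex[OF memB(1)] obtain c where c: "c \<in> centralizer a" "p0 + p1 \<star> s = (q0 + q1 \<star> s) \<star> c" ..
  have *: "\<exists>\<alpha>\<in>centralizer a. q1 = p0 \<star> \<alpha> - q0 \<star> (c * \<alpha> + inverse t)"
    if "s \<noteq> t" "t \<in> ?B - {0, s0}" for t
  proof -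
    from ex[OF that(2)] obtain c' where c': "c' \<in> centralizer a" "p0 + p1 \<star> t = (q0 + q1 \<star> t) \<star> c'" ..
    show ?thesis
      by (rule independent_pair_line_aux[OF ind _ _ _ _ that(1) c c']) (use that(2) memB(1) in blast)+
  qed
  obtain \<alpha> where \<alpha>: "\<alpha> \<in> centralizer a" "q1 = p0 \<star> \<alpha> - q0 \<star> (c * \<alpha> + inverse t)"
    using *[OF stt(1) memB(2)] ..
  obtain \<beta> where \<beta>: "\<beta> \<in> centralizer a" "q1 = p0 \<star> \<beta> - q0 \<star> (c * \<beta> + inverse t')"
    using *[OF stt(2) memB(3)] ..
  have eq: "p0 \<star> (\<alpha> - \<beta>) = q0 \<star> (c * (\<alpha> - \<beta>) + (inverse t - inverse t'))"
  proof -
    have "p0 \<star> \<alpha> - q0 \<star> (c * \<alpha> + inverse t) = p0 \<star> \<beta> - q0 \<star> (c * \<beta> + inverse t')"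
      using trans[OF \<alpha>(2)[symmetric] \<beta>(2)] .
    moreover have "x - z = y - w" if "x - y = z - w" for x y z w :: "'a ^'n"
      using that by (simp add: algebra_simps)
    ultimately have "p0 \<star> \<alpha> - p0 \<star> \<beta> = q0 \<star> (c * \<alpha> + inverse t) - q0 \<star> (c * \<beta> + inverse t')"
      by blast
    moreover have "c * \<alpha> + inverse t - (c * \<beta> + inverse t') = c * (\<alpha> - \<beta>) + (inverse t - inverse t')"
      by (simp add: right_diff_distrib)
    ultimately show ?thesis by (simp only: rscale_distrib(4)[symmetric])
  qed
  show False
  proof (cases "\<alpha> = \<beta>")
    case True
    have "q0 \<star> (inverse t - inverse t') = 0" using eq unfolding True by simp
    then show False using stt(3) q0 by simp
  next
    case False
    have "p0 = p0 \<star> (\<alpha> - \<beta>) \<star> inverse (\<alpha> - \<beta>)" using False by simp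
    also have "\<dots> = q0 \<star> ((c * (\<alpha> - \<beta>) + (inverse t - inverse t')) * inverse (\<alpha> - \<beta>))"
      unfolding eq by simp
    finally have p0: "p0 = q0 \<star> ((c * (\<alpha> - \<beta>) + (inverse t - inverse t')) * inverse (\<alpha> - \<beta>))" .
    have "t \<in> ring_center" "t' \<in> ring_center" using memB by blast+
    then have "(c * (\<alpha> - \<beta>) + (inverse t - inverse t')) * inverse (\<alpha> - \<beta>) \<in> centralizer a"
      using c(1) \<alpha>(1) \<beta>(1) by (simp add: centralizer_mult centralizer_closed)
    then show False using p0 ind unfolding independent_pair_def by blast
  qed
qed

text \<open>Comparing the eigenvalues at \<open>v\<close>, \<open>f\<close> and \<open>v + f\<close>
  shows that \<open>v\<close> has the same eigenvalue as \<open>f\<close> whenever \<open>v\<close>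
  is outside the line of \<open>f\<close>. Vectors on that line are reached as
  \<open>(v + e) - e\<close>. So \<open>A\<close> acts as one right scalar, which commutes with
  every matrix.\<close>

lemma central_if_all_eigenvectors:
  fixes A :: "'a::division_ring ^'n^'n" and e f :: "'a ^'n"
  assumes A: "A \<in> carrier GL_mat" and ind: "independent_pair a e f"
    and eig: "\<And>v. \<not> independent_pair a (A *v v) v"
  shows "A \<in> group_center GL_mat"
proof -
  have eig': "\<exists>c\<in>centralizer a. A *v v = v \<star> c" for v
    using eig[of v] centralizer_closed(1) unfolding independent_pair_def by (cases "v = 0") auto
  have f: "f \<noteq> 0" "\<And>c. c \<in> centralizer a \<Longrightarrow> e \<noteq> f \<star> c"
    using ind by (auto simp: independent_pair_def)
  obtain c0 where c0: "c0 \<in> centralizer a" "A *v f = f \<star> c0" using eig' by blast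
  have *: "A *v v = v \<star> c0" if v: "\<And>c. c \<in> centralizer a \<Longrightarrow> v \<noteq> f \<star> c" for v
  proof -
    obtain c where c: "c \<in> centralizer a" "A *v v = v \<star> c" using eig' by blast
    obtain c' where c': "c' \<in> centralizer a" "A *v (v + f) = (v + f) \<star> c'" using eig' by blast
    have eq: "v \<star> (c - c') = f \<star> (c' - c0)"
      using c'(2) c(2) c0(2) by (simp add: mult_vec_add rscale_distrib algebra_simps)
    have "c = c'"
    proof (rule ccontr)
      assume "c \<noteq> c'"
      then have "v = v \<star> (c - c') \<star> inverse (c - c')" by simp
      also have "\<dots> = f \<star> ((c' - c0) * inverse (c - c'))" unfolding eq by simp
      finally show False
        using v centralizer_mult centralizer_closed(5,7) c(1) c'(1) c0(1) by metis
    qed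
    then show ?thesis using eq f(1) c by simp
  qed
  have all: "A *v v = v \<star> c0" for v
  proof (cases "\<exists>c\<in>centralizer a. v = f \<star> c")
    case True
    then obtain d where d: "d \<in> centralizer a" "v = f \<star> d" by blast
    have "v + e \<noteq> f \<star> c" if "c \<in> centralizer a" for c
    proof
      assume "v + e = f \<star> c"
      then have "e = f \<star> (c - d)" using d by (simp add: rscale_distrib algebra_simps)
      then show False using f(2) that d(1) centralizer_closed(7) by blast
    qed
    then have "A *v (v + e) = (v + e) \<star> c0" by (rule *)
    moreover have "A *v e = e \<star> c0" by (rule *) (rule f(2))
    ultimately show ?thesis by (simp add: mult_vec_add rscale_distrib)
  qed (use * in blast)
  have "A ** B = B ** A" for B
    by (simp add: matrix_eq matrix_vector_mul_assoc[symmetric] all mult_rscale)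
  then show ?thesis using A by (simp add: group_center_def)
qed

section \<open>The top coefficient of the expansion\<close>

lemma independent_pair_scale:
  assumes "independent_pair a p q" "s \<in> ring_center" "s \<noteq> 0"
  shows "independent_pair a (p \<star> s) (q \<star> s)"
  unfolding independent_pair_def
proof (intro conjI ballI notI)
  show "q \<star> s = 0 \<Longrightarrow> False" using assms by (simp add: independent_pair_def)
next
  fix c assume c: "c \<in> centralizer a" "p \<star> s = q \<star> s \<star> c"
  have "p \<star> s = q \<star> c \<star> s" using c(2) ring_centerD[OF assms(2), of c] by simp
  then have "(p - q \<star> c) \<star> s = 0" by (simp add: rscale_distrib)
  then have "p = q \<star> c" using assms(3) by simp
  then show False using assms(1) c(1) unfolding independent_pair_def by blast
qed

lemma rspan_matrix: "x \<in> rspan a S \<Longrightarrow> A *v x \<in> rspan a ((*v) A ` S)"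
proof (induction rule: rspan.induct)
  case rspan_zero
  show ?case by (simp add: rspan.rspan_zero)
next
  case (rspan_step x s c)
  then show ?case unfolding mult_vec_add mult_rscale by (intro rspan.rspan_step) auto
qed

lemma operators_rank_one_rspan:
  assumes y: "y \<in> operators a m" and S: "\<And>x. x \<in> S \<Longrightarrow> \<exists>c\<in>centralizer a. y x = w \<star> c"
    and x: "x \<in> rspan a S"
  shows "\<exists>c\<in>centralizer a. y x = w \<star> c"
  using x
proof induction
  case rspan_zero
  show ?case by (rule bexI[of _ 0]) (simp_all add: centralizer_closed operators_linear[OF y])
next
  case (rspan_step x s d)
  from rspan_step.IH obtain c where c: "c \<in> centralizer a" "y x = w \<star> c" ..
  from S[OF rspan_step.hyps(2)] obtain c' where c': "c' \<in> centralizer a" "y s = w \<star> c'" ..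
  have "y (x + s \<star> d) = w \<star> (c + c' * d)"
    using rspan_step.hyps(3) by (simp add: operators_linear[OF y] c(2) c'(2) rscale_distrib)
  moreover have "c + c' * d \<in> centralizer a"
    using c(1) c'(1) rspan_step.hyps(3) by (simp add: centralizer_closed centralizer_mult)
  ultimately show ?case by (rule bexI)
qed

text \<open>For a single \<open>u\<close> a rank one operator with \<open>y u = w\<close> and
  \<open>y w = 0\<close> exists by independence. The admissible operators are closed under central
  lines, so \<open>generic_choice\<close> handles all of \<open>U\<close> at once.\<close>

lemma operator_choice:
  fixes w :: "'a::division_ring ^'n"
  assumes inf: "infinite (ring_center :: 'a set)" and fin: "finite X'" "finite U" and w: "w \<noteq> 0"
    and U: "\<And>u. u \<in> U \<Longrightarrow> independent_pair a u w"
  shows "\<exists>y m. y \<in> operators a m \<and> y w = 0 \<and> (\<forall>x\<in>X'. \<exists>c\<in>centralizer a. y x = w \<star> c) \<and> (\<forall>u\<in>U. y u \<noteq> 0)"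
proof -
  define Y where "Y = {y. (\<exists>m. y \<in> operators a m) \<and> y w = 0 \<and> (\<forall>x\<in>X'. \<exists>c\<in>centralizer a. y x = w \<star> c)}"
  have "\<exists>y\<in>Y. \<forall>u\<in>U. y u \<noteq> 0"
  proof (rule generic_choice[OF inf fin(2)])
    have "(\<lambda>x. 0 *v x) \<in> Y"
      unfolding Y_def using operators_matrix[of 0 a]
      by (auto intro!: bexI[of _ 0] simp: centralizer_closed)
    then show "Y \<noteq> {}" by blast
  next
    fix y y' and s :: 'a assume y: "y \<in> Y" and y': "y' \<in> Y" and s: "s \<in> ring_center"
    obtain m m' where "y \<in> operators a m" "y' \<in> operators a m'" using y y' unfolding Y_def by blast
    then have m: "y \<in> operators a (max m m')" "y' \<in> operators a (max m m')"
      using operators_mono[of m "max m m'" a] operators_mono[of m' "max m m'" a] by auto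
    have "\<exists>c\<in>centralizer a. y x + y' x \<star> s = w \<star> c" if x: "x \<in> X'" for x
    proof -
      obtain c where c: "c \<in> centralizer a" "y x = w \<star> c" using y x unfolding Y_def by blast
      obtain c' where c': "c' \<in> centralizer a" "y' x = w \<star> c'" using y' x unfolding Y_def by blast
      show ?thesis
        by (rule bexI[of _ "c + c' * s"])
          (use c c' s in \<open>simp_all add: rscale_distrib centralizer_closed centralizer_mult\<close>)
    qed
    moreover have "y w + y' w \<star> s = 0" using y y' unfolding Y_def by simp
    ultimately show "(\<lambda>x. y x + y' x \<star> s) \<in> Y"
      unfolding Y_def using operators_add[OF m(1) operators_central[OF m(2) s]] by blast
  next
    fix u assume u: "u \<in> U"
    have "u \<notin> rspan a {w}"
    proof
      assume "u \<in> rspan a {w}"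
      then obtain c where c: "c \<in> centralizer a" "u - w \<star> c \<in> rspan a {}"
        using rspan_insert_iff by blast
      have "x = 0" if "x \<in> rspan a {}" for x :: "'a ^'n" using that by (cases rule: rspan.cases) auto
      then have "u = w \<star> c" using c(2) by fastforce
      then show False using U[OF u] c(1) unfolding independent_pair_def by blast
    qed
    from rank_one_operator[OF fin(1) _ this, of w] obtain m y where
      y: "y \<in> operators a m" "\<forall>s\<in>{w}. y s = 0" "\<forall>x\<in>X'. \<exists>c\<in>centralizer a. y x = w \<star> c" "y u = w"
      by blast
    then have "y \<in> Y" unfolding Y_def by blast
    moreover have "y u \<noteq> 0" using y(4) w by simp
    ultimately show "\<exists>y\<in>Y. y u \<noteq> 0" by (intro bexI[of _ y])
  next
    fix u y y' assume "y u \<noteq> (0 :: 'a ^'n)"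
    have "s = s'" if "y u + y' u \<star> s = 0" "y u + y' u \<star> s' = 0" for s s'
    proof (rule ccontr)
      assume "s \<noteq> s'"
      have "y' u \<star> (s - s') = (y u + y' u \<star> s) - (y u + y' u \<star> s')" by (simp add: rscale_distrib)
      then have "y' u \<star> (s - s') = 0" unfolding that by simp
      then have "y' u = 0" using \<open>s \<noteq> s'\<close> by simp
      then show False using that(1) \<open>y u \<noteq> 0\<close> by simp
    qed
    then have "\<exists>s0. {s \<in> ring_center. \<not> y u + y' u \<star> s \<noteq> 0} \<subseteq> {s0}"
      by (cases "\<exists>s. y u + y' u \<star> s = 0") blast+
    then show "finite {s \<in> ring_center. \<not> y u + y' u \<star> s \<noteq> 0}"
      using finite_subset by blast
  next
    fix u y s assume "y u \<noteq> (0 :: 'a ^'n)" "s \<noteq> (0 :: 'a)"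
    then show "y u \<star> s \<noteq> 0" by simp
  qed
  then show ?thesis unfolding Y_def by blast
qed

text \<open>What survives in the top coefficient up to a nonzero right scalar: the operator of the
  first letter maps into the line of \<open>v i\<close>, so the letters behind it affect only the
  scalar. The argument \<open>u\<close> stands for \<open>l *v z\<close>.\<close>

fun leading_vector :: "'a::division_ring ^'n \<Rightarrow> (nat \<Rightarrow> 'a ^'n) \<Rightarrow>
    (('a ^'n^'n) \<times> nat \<times> int) list \<Rightarrow> 'a ^'n" where
  "leading_vector u v [] = u"
| "leading_vector u v ((A, i, \<alpha>) # ws) = A *v v i"

text \<open>A finite set whose span over the centralizer contains all coefficients of the expansion.
  Density can only be applied to such a finite set.\<close>

fun reachable :: "'a::division_ring ^'n \<Rightarrow> (nat \<Rightarrow> 'a ^'n) \<Rightarrow>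
    (('a ^'n^'n) \<times> nat \<times> int) list \<Rightarrow> ('a ^'n) set" where
  "reachable u v [] = {u}"
| "reachable u v ((A, i, \<alpha>) # ws) = reachable u v ws \<union> (*v) A ` insert (v i) (reachable u v ws)"

lemma finite_reachable: "finite (reachable u v ws)"
  by (induction ws) auto

lemma leading_vector_reachable: "leading_vector u v ws \<in> reachable u v ws"
  by (cases ws) auto

lemma reachable_mono: "suffix s ws \<Longrightarrow> reachable u v s \<subseteq> reachable u v ws"
proof (induction ws)
  case (Cons w ws)
  obtain A i \<alpha> where "w = (A, i, \<alpha>)" by (cases w) auto
  then have "reachable u v ws \<subseteq> reachable u v (w # ws)" by auto
  then show ?case using Cons unfolding suffix_Cons by blast
qed simp

text \<open>If every \<open>y\<^sub>i\<close> acts on the vectors that occur as a square-zero operator with image in the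
  line of \<open>v\<^sub>i\<close>, then \<open>(1 + t y\<^sub>i)\<^sup>\<plusminus>\<^sup>1 = 1 \<plusminus> t y\<^sub>i\<close> there, the expansion is a polynomial of
  degree at most \<open>length ws\<close>, and its top coefficient is the product of all \<open>A\<^sub>j y\<^sub>j\<close>.\<close>

lemma expansion_top:
  fixes v :: "nat \<Rightarrow> 'a::division_ring ^'n"
  assumes "\<And>A i \<alpha> s. suffix ((A, i, \<alpha>) # s) ws \<Longrightarrow> y i \<in> operators a m \<and> y i (v i) = 0 \<and>
      (\<forall>x\<in>reachable (l *v z) v s. \<exists>c\<in>centralizer a. y i x = v i \<star> c) \<and>
      y i (leading_vector (l *v z) v s) \<noteq> 0"
  shows "(\<forall>k. expansion ws l y z k \<in> rspan a (reachable (l *v z) v ws)) \<and>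
    (\<forall>k>length ws. expansion ws l y z k = 0) \<and>
    (\<exists>c\<in>centralizer a. c \<noteq> 0 \<and> expansion ws l y z (length ws) = leading_vector (l *v z) v ws \<star> c)"
  using assms
proof (induction ws)
  case Nil
  have "\<exists>c\<in>centralizer a. c \<noteq> 0 \<and> l *v z = (l *v z) \<star> c"
    by (rule bexI[of _ 1]) (simp_all add: centralizer_closed)
  then show ?case using rspan_base[of "l *v z" "{l *v z}" a] rspan_zero[of a "{l *v z}"] by simp
next
  case (Cons w s)
  obtain A i \<alpha> where w: "w = (A, i, \<alpha>)" by (cases w) auto
  let ?u = "l *v z"
  define b where "b = expansion s l y z"
  have sfx: "suffix ((A', i', \<alpha>') # s') (w # s)" if "suffix ((A', i', \<alpha>') # s') s" for A' i' \<alpha>' s'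
    using that by (rule suffix_ConsI)
  have IH: "\<forall>k. b k \<in> rspan a (reachable ?u v s)" "\<forall>k>length s. b k = 0"
    "\<exists>c\<in>centralizer a. c \<noteq> 0 \<and> b (length s) = leading_vector ?u v s \<star> c"
    using Cons.IH[OF Cons.prems[OF sfx]] unfolding b_def by simp_all
  have "suffix ((A, i, \<alpha>) # s) (w # s)" unfolding w by simp
  from Cons.prems[OF this] have y: "y i \<in> operators a m" and y0: "y i (v i) = 0"
    and yX: "\<And>x. x \<in> reachable ?u v s \<Longrightarrow> \<exists>c\<in>centralizer a. y i x = v i \<star> c"
    and ylead: "y i (leading_vector ?u v s) \<noteq> 0" by simp_all
  note lin = operators_linear[OF y]
  have yb: "\<exists>c\<in>centralizer a. y i (b k) = v i \<star> c" for k
    using operators_rank_one_rspan[OF y yX] IH(1) by blast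
  have yy: "y i (y i (b k)) = 0" for k
  proof -
    from yb[of k] obtain c where "c \<in> centralizer a" "y i (b k) = v i \<star> c" ..
    then show ?thesis using y0 by (simp add: lin)
  qed
  define T where "T = (if \<alpha> = 1 then linear_factor else geometric) (y i) b"
  define \<epsilon> :: 'a where "\<epsilon> = (if \<alpha> = 1 then 1 else - 1)"
  have geo: "y i (geometric (y i) b k) = y i (b k)" for k
  proof (induction k)
    case (Suc k)
    then show ?case by (simp add: lin yy)
  qed simp
  have T: "T 0 = b 0" "\<And>k. T (Suc k) = b (Suc k) + y i (b k) \<star> \<epsilon>"
    unfolding T_def \<epsilon>_def by (simp_all add: geo)
  have exp: "expansion (w # s) l y z k = A *v T k" for k
    unfolding w T_def b_def by simp
  have \<epsilon>: "\<epsilon> \<in> centralizer a" "\<epsilon> \<noteq> 0" unfolding \<epsilon>_def by (simp_all add: centralizer_closed)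
  let ?S = "insert (v i) (reachable ?u v s)"
  have bS: "b k \<in> rspan a ?S" for k using IH(1) by (blast intro: rspan_mono)
  have TS: "T k \<in> rspan a ?S" for k
  proof (cases k)
    case 0
    then show ?thesis using T(1) bS by simp
  next
    case (Suc k')
    from yb[of k'] obtain c where c: "c \<in> centralizer a" "y i (b k') = v i \<star> c" ..
    have "T k = b k + v i \<star> (c * \<epsilon>)" using Suc T(2) c(2) by simp
    also have "\<dots> \<in> rspan a ?S"
      by (rule rspan_step[OF bS insertI1 centralizer_mult[OF c(1) \<epsilon>(1)]])
    finally show ?thesis .
  qed
  have "expansion (w # s) l y z k \<in> rspan a (reachable ?u v (w # s))" for k
    unfolding exp by (rule rspan_mono[OF rspan_matrix[OF TS]]) (auto simp: w)
  moreover have "expansion (w # s) l y z k = 0" if k: "length (w # s) < k" for k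
  proof -
    obtain k' where k': "k = Suc k'" "length s < k'" using k by (cases k) auto
    have "T k = 0" unfolding k'(1) T(2) using IH(2) k'(2) by (simp add: lin)
    then show ?thesis unfolding exp by simp
  qed
  moreover have "\<exists>c\<in>centralizer a. c \<noteq> 0 \<and>
    expansion (w # s) l y z (length (w # s)) = leading_vector ?u v (w # s) \<star> c"
  proof -
    obtain c where c: "c \<in> centralizer a" "c \<noteq> 0" "b (length s) = leading_vector ?u v s \<star> c"
      using IH(3) by blast
    from yX[OF leading_vector_reachable] obtain d where
      d: "d \<in> centralizer a" "y i (leading_vector ?u v s) = v i \<star> d" ..
    have "d \<noteq> 0" using d(2) ylead by auto
    have lead: "leading_vector ?u v (w # s) = A *v v i" by (simp add: w)
    \<comment> \<open>In this degree \<open>b\<close> itself already vanishes; what remains is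
      \<open>y i\<close> applied to the top coefficient of the suffix.\<close>
    have "T (length (w # s)) = v i \<star> (d * c * \<epsilon>)"
      using IH(2) c d(2) by (simp add: T(2) lin mult.assoc)
    then have "expansion (w # s) l y z (length (w # s)) = leading_vector ?u v (w # s) \<star> (d * c * \<epsilon>)"
      unfolding exp lead by (simp add: mult_rscale)
    moreover have "d * c * \<epsilon> \<in> centralizer a" using c(1) d(1) \<epsilon>(1) by (simp add: centralizer_mult)
    moreover have "d * c * \<epsilon> \<noteq> 0" using \<open>d \<noteq> 0\<close> c(2) \<epsilon>(2) by simp
    ultimately show ?thesis by blast
  qed
  ultimately show ?case by blast
qed

lemma generic_vectors:
  fixes e f :: "'a::division_ring ^'n"
  assumes inf: "infinite (ring_center :: 'a set)" and ind: "independent_pair a e f"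
    and alt: "alternating (GL_mat :: ('a ^'n^'n) monoid) ws"
    and i0: "\<And>A i \<alpha>. (A, i, \<alpha>) \<in> set ws \<Longrightarrow> i \<noteq> i0"
  shows "\<exists>v. \<forall>A i \<alpha> s. suffix ((A, i, \<alpha>) # s) ws \<longrightarrow>
    independent_pair a (leading_vector (v i0) v s) (v i)"
proof -
  define Q where "Q = {(i, s). \<exists>A \<alpha>. suffix ((A, i, \<alpha>) # s) ws}"
  have "Q \<subseteq> (\<lambda>s. (fst (snd (hd s)), tl s)) ` set (suffixes ws)"
    unfolding Q_def by force
  then have fin: "finite Q" using finite_subset by blast
  let ?P = "\<lambda>(q :: nat \<times> (('a ^'n^'n) \<times> nat \<times> int) list) (v :: nat \<Rightarrow> 'a ^'n).
    independent_pair a (leading_vector (v i0) v (snd q)) (v (fst q))"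
  have lead: "leading_vector (v i0 + v' i0 \<star> s) (\<lambda>i. v i + v' i \<star> s) ws =
    leading_vector (v i0) v ws + leading_vector (v' i0) v' ws \<star> s" for v v' :: "nat \<Rightarrow> 'a ^'n" and s ws
    by (cases ws) (auto simp: mult_vec_add mult_rscale)
  have lead': "leading_vector (v i0 \<star> s) (\<lambda>i. v i \<star> s) ws = leading_vector (v i0) v ws \<star> s"
    for v :: "nat \<Rightarrow> 'a ^'n" and s ws
    by (cases ws) (auto simp: mult_rscale)
  have "\<exists>v\<in>UNIV. \<forall>q\<in>Q. ?P q v"
  proof (rule generic_choice[OF inf fin])
    fix q assume "q \<in> Q"
    then obtain A i \<alpha> s where q: "q = (i, s)" and sfx: "suffix ((A, i, \<alpha>) # s) ws" unfolding Q_def by blast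
    obtain pre where ws: "ws = pre @ (A, i, \<alpha>) # s" using sfx unfolding suffix_def by blast
    show "\<exists>v\<in>UNIV. ?P q v"
    proof (cases s)
      case Nil
      have "i \<noteq> i0" using i0[of A i \<alpha>] ws by simp
      then show ?thesis
        by (intro bexI[of _ "\<lambda>k. if k = i then f else e"]) (use ind q Nil in simp_all)
    next
      case (Cons x s')
      obtain B j \<beta> where x: "x = (B, j, \<beta>)" by (cases x) auto
      have B: "B \<in> carrier GL_mat" and nc: "i = j \<longrightarrow> B \<notin> group_center GL_mat"
        using alt unfolding ws Cons x alternating_def by (auto simp: successively_append_iff)
      show ?thesis
      proof (cases "i = j")
        case True
        then obtain v0 where "independent_pair a (B *v v0) v0"
          using central_if_all_eigenvectors[OF B ind] nc by blast
        then show ?thesis by (intro bexI[of _ "\<lambda>_. v0"]) (use True q Cons x in simp_all)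
      next
        case False
        have "B *v (inv\<^bsub>GL_mat\<^esub> B *v e) = e"
          using GL_inverse(2)[OF B] by (simp add: matrix_vector_mul_assoc)
        then show ?thesis
          by (intro bexI[of _ "\<lambda>k. if k = i then f else inv\<^bsub>GL_mat\<^esub> B *v e"])
            (use ind False q Cons x in simp_all)
      qed
    qed
  next
    fix q v v' assume "?P q v"
    then show "finite {s \<in> ring_center. \<not> ?P q (\<lambda>i. v i + v' i \<star> s)}"
      unfolding lead[of v v' _ "snd q"] by (rule independent_pair_line)
  next
    fix q v and s :: 'a assume "?P q v" "s \<in> ring_center" "s \<noteq> 0"
    then show "?P q (\<lambda>i. v i \<star> s)" unfolding lead'[of v _ "snd q"] by (rule independent_pair_scale)
  qed simp_all
  then show ?thesis unfolding Q_def by fastforce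
qed

lemma no_alternating_identity:
  fixes e f :: "'a::division_ring ^'n"
  assumes inf: "infinite (ring_center :: 'a set)" and ind: "independent_pair a e f"
    and ws: "ws \<noteq> []" "alternating (GL_mat :: ('a ^'n^'n) monoid) ws" and l: "l \<in> carrier GL_mat"
    and id: "\<And>c. (\<forall>i. c i \<in> carrier GL_mat) \<Longrightarrow> eval_monomial GL_mat ws l c = mat 1"
  shows False
proof -
  have mem: "\<forall>(A, i, \<alpha>) \<in> set ws. A \<in> carrier GL_mat \<and> \<bar>\<alpha>\<bar> = 1" using ws(2) unfolding alternating_def by blast
  define J where "J = (\<lambda>(A, i, \<alpha>). i) ` set ws"
  have J: "finite J" unfolding J_def by simp
  have memJ: "i \<in> J" if "(A, i, \<alpha>) \<in> set ws" for A i \<alpha> using that unfolding J_def by force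
  obtain i0 where i0: "i0 \<notin> J" using ex_new_if_finite[OF infinite_UNIV_nat J] by blast
  obtain v where v: "\<And>A i \<alpha> s. suffix ((A, i, \<alpha>) # s) ws \<Longrightarrow>
      independent_pair a (leading_vector (v i0) v s) (v i)"
    using generic_vectors[OF inf ind ws(2), of i0] memJ i0 by metis
  \<comment> \<open>Invertibility of \<open>l\<close> lets the start vector \<open>l *v z\<close> be
    the generic vector \<open>v i0\<close>.\<close>
  define z where "z = inv\<^bsub>GL_mat\<^esub> l *v v i0"
  have lz: "l *v z = v i0" unfolding z_def using GL_inverse(2)[OF l] by (simp add: matrix_vector_mul_assoc)
  define U where "U i = {leading_vector (v i0) v s | s A \<alpha>. suffix ((A, i, \<alpha>) # s) ws}" for i
  have finU: "finite (U i)" for i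
  proof -
    have "U i \<subseteq> (\<lambda>s. leading_vector (v i0) v (tl s)) ` set (suffixes ws)" unfolding U_def by force
    then show ?thesis using finite_subset by blast
  qed
  have vnz: "v i \<noteq> 0" if i: "i \<in> J" for i
  proof -
    obtain A \<alpha> where "(A, i, \<alpha>) \<in> set ws" using i unfolding J_def by force
    then obtain pre s where "ws = pre @ (A, i, \<alpha>) # s" by (meson split_list)
    then have "suffix ((A, i, \<alpha>) # s) ws" unfolding suffix_def by blast
    from v[OF this] show ?thesis unfolding independent_pair_def by blast
  qed
  have "\<exists>y m. y \<in> operators a m \<and> y (v i) = 0 \<and>
    (\<forall>x\<in>reachable (v i0) v ws. \<exists>c\<in>centralizer a. y x = v i \<star> c) \<and> (\<forall>u\<in>U i. y u \<noteq> 0)" if "i \<in> J" for i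
    by (rule operator_choice[OF inf finite_reachable finU vnz[OF that]]) (use v in \<open>auto simp: U_def\<close>)
  then obtain y0 m0 where y0: "\<And>i. i \<in> J \<Longrightarrow> y0 i \<in> operators a (m0 i) \<and> y0 i (v i) = 0 \<and>
    (\<forall>x\<in>reachable (v i0) v ws. \<exists>c\<in>centralizer a. y0 i x = v i \<star> c) \<and> (\<forall>u\<in>U i. y0 i u \<noteq> 0)"
    by metis
  define m where "m = Max (m0 ` J)"
  define y where "y i = (if i \<in> J then y0 i else (\<lambda>_. 0))" for i
  have ym: "y i \<in> operators a m" if "i \<in> J" for i
  proof -
    have "m0 i \<le> m" unfolding m_def using J that by simp
    then show ?thesis using y0[OF that] operators_mono that unfolding y_def by auto
  qed
  have zero: "expansion ws l y z (Suc k) = 0" for k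
  proof (rule expansion_eq_0_operators[OF inf, where J = J and a = a and m = m])
    show "expansion ws l (\<lambda>i x. Y i *v x) z (Suc k) = 0" if "\<And>i. i \<notin> J \<Longrightarrow> Y i = 0" for Y
      by (rule expansion_eq_0_matrices[OF inf mem l id J that])
    show "y i \<in> operators a m" if "i \<in> J" for i by (rule ym[OF that])
    show "y i x = 0" if "i \<notin> J" for i x using that by (simp add: y_def)
  qed
  have top: "\<exists>c\<in>centralizer a. c \<noteq> 0 \<and> expansion ws l y z (length ws) = leading_vector (l *v z) v ws \<star> c"
  proof (rule expansion_top[THEN conjunct2, THEN conjunct2])
    fix A i \<alpha> s assume sfx: "suffix ((A, i, \<alpha>) # s) ws"
    have i: "i \<in> J" using set_mono_suffix[OF sfx] memJ by auto
    have s: "reachable (v i0) v s \<subseteq> reachable (v i0) v ws" by (rule reachable_mono[OF suffix_ConsD[OF sfx]])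
    have "leading_vector (v i0) v s \<in> U i" unfolding U_def using sfx by blast
    then show "y i \<in> operators a m \<and> y i (v i) = 0 \<and>
      (\<forall>x\<in>reachable (l *v z) v s. \<exists>c\<in>centralizer a. y i x = v i \<star> c) \<and>
      y i (leading_vector (l *v z) v s) \<noteq> 0"
      using y0[OF i] ym[OF i] s i unfolding lz y_def by auto
  qed
  \<comment> \<open>The word is nonempty, so its top coefficient has positive degree and must vanish
    by \<open>zero\<close>.\<close>
  obtain A i \<alpha> s where w: "ws = (A, i, \<alpha>) # s" using ws(1) by (metis list.exhaust prod.exhaust)
  have "expansion ws l y z (length ws) = 0" using zero[of "length s"] w by simp
  then have "A *v v i = 0" using top w by auto
  then have "inv\<^bsub>GL_mat\<^esub> A *v (A *v v i) = 0" by simp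
  moreover have "A \<in> carrier GL_mat" using mem w by auto
  ultimately have "v i = 0" using GL_inverse(1)[of A] by (simp add: matrix_vector_mul_assoc)
  then show False using vnz[OF memJ, of A i \<alpha>] w by simp
qed

text \<open>If \<open>D\<close> is noncommutative, a noncentral \<open>a\<close> works already
  within one coordinate, where 1 and an element outside the centralizer are independent. If
  \<open>D\<close> is commutative, noncommuting matrices force n to be at least 2, and two basis
  vectors do.\<close>

lemma ex_independent_pair:
  fixes A B :: "'a::division_ring ^'n^'n"
  assumes "A ** B \<noteq> B ** A"
  shows "\<exists>a (e :: 'a ^'n) f. independent_pair a e f"
proof (cases "\<exists>a u :: 'a. u * a \<noteq> a * u")
  case True
  then obtain a u :: 'a where "u \<notin> centralizer a" unfolding centralizer_def by blast
  then have "axis undefined u \<noteq> (axis undefined 1 :: 'a ^'n) \<star> c" if "c \<in> centralizer a" for c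
    using that by (auto simp: vec_eq_iff axis_def)
  then have "independent_pair a (axis undefined u) (axis undefined 1 :: 'a ^'n)"
    unfolding independent_pair_def by simp
  then show ?thesis by blast
next
  case False
  have "\<exists>i j :: 'n. i \<noteq> j"
  proof (rule ccontr)
    assume "\<not> ?thesis"
    then have one: "(UNIV :: 'n set) = {i}" for i by auto
    have "(A ** B) $ i $ j = (B ** A) $ i $ j" for i j
      using False \<open>\<not> (\<exists>i j :: 'n. i \<noteq> j)\<close> by (simp add: matrix_matrix_mult_def one[of i]) metis
    then show False using assms by (simp add: vec_eq_iff)
  qed
  then obtain i j :: 'n where ij: "i \<noteq> j" by blast
  have "axis i 1 \<noteq> (axis j 1 :: 'a ^'n) \<star> c" for c
  proof
    assume "axis i 1 = (axis j 1 :: 'a ^'n) \<star> c"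
    then have "(axis i 1 :: 'a ^'n) $ i = ((axis j 1 :: 'a ^'n) \<star> c) $ i" by simp
    then show False using ij by (simp add: axis_def)
  qed
  then have "independent_pair 1 (axis i 1) (axis j 1 :: 'a ^'n)" unfolding independent_pair_def by simp
  then show ?thesis by blast
qed

theorem theorem2p2:
  fixes G :: "('a::division_ring ^'n^'n) set"
  assumes "infinite (ring_center :: 'a set)"
    and "subgroup G (GL_mat :: ('a ^'n^'n) monoid)"
    and "almost_subnormal (GL_mat :: ('a ^'n^'n) monoid) G"
    and "satisfies_ggi (GL_mat :: ('a ^'n^'n) monoid) G"
  shows "G \<subseteq> group_center (GL_mat :: ('a ^'n^'n) monoid)"
proof (rule ccontr)
  interpret GL: group "GL_mat :: ('a ^'n^'n) monoid" by (rule group_GL_mat)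
  assume nc: "\<not> G \<subseteq> group_center (GL_mat :: ('a ^'n^'n) monoid)"
  then obtain A where A: "A \<in> G" "A \<notin> group_center GL_mat" by blast
  have "A \<in> carrier GL_mat" using subgroup.mem_carrier[OF assms(2) A(1)] .
  then obtain B where "A ** B \<noteq> B ** A" using A(2) by (auto simp: group_center_def)
  then obtain a :: 'a and e f :: "'a ^'n" where ind: "independent_pair a e f"
    using ex_independent_pair by blast
  have "satisfies_ggi GL_mat (carrier (GL_mat :: ('a ^'n^'n) monoid))"
    by (rule GL.satisfies_ggi_almost_subnormal[OF assms(3,4) nc])
  from GL.satisfies_ggi_alternating[OF GL.subgroup_self this]
  obtain ws and l :: "'a ^'n^'n" where ws: "ws \<noteq> []" "alternating GL_mat ws" "l \<in> carrier GL_mat"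
    and id: "\<And>c. (\<forall>i. c i \<in> carrier GL_mat) \<Longrightarrow> eval_monomial GL_mat ws l c = \<one>\<^bsub>GL_mat\<^esub>"
    by blast
  show False
    by (rule no_alternating_identity[OF assms(1) ind ws(1,2,3)]) (use id in simp)
qed

end
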